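(* Let $f\in\mathcal{SR}(\mathbb B^4(0,1))$ be given by $f(x)=\sum_{n=0}^\infty x^na_n$ on $\mathbb B^4(0,1)$, with $a_n\in\mathbb H$, such that the function series $$\sum_{n=1}^\infty\Big\{\mathcal T\Big[-2\,\mathbf x\sum_{k=1}^n(\overline x)^{k-1}x^{n-k}+3x^n\Big]\Big\}a_n$$ is uniformly convergent on compact subsets of $\mathbb B^4(0,1)$. Then the function series $\sum_{n=0}^\infty\xi_n(x)\,a_n$ belongs to $\mathcal M(\mathbb B^4(0,1))$, where, for $x\in\mathbb B^4(0,1)$, $$\xi_0(x)=\mathbf x+3\,\mathcal T[1](x),\qquad \xi_n(x)=\mathbf x\,x^n-2\sum_{k=1}^n\mathcal T\big[\mathbf x\,(\overline x)^{k-1}x^{n-k}\big](x)+3\,\mathcal T[x^n](x)\quad(n\ge1).$$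
   Context: $\mathbb H\cong\mathbb R^4$ is the skew field of real quaternions $x=x_0+x_1\mathbf e_1+x_2\mathbf e_2+x_3\mathbf e_3$, with $\mathbf e_k^2=-1$ and $\mathbf e_1\mathbf e_2\mathbf e_3=-1$; $\mathbf e_0=1$. $\mathbf x=x_1\mathbf e_1+x_2\mathbf e_2+x_3\mathbf e_3$ is the vector part and $\overline x=x_0-\mathbf x$ the conjugate of $x$. $\mathbb B^4(0,1)=\{x\in\mathbb H\mid\|x\|<1\}$. $\mathcal{SR}(\mathbb B^4(0,1))$ is the set of slice regular functions: real differentiable $f:\mathbb B^4(0,1)\to\mathbb H$ such that for every $\mathbf i$ in the unit sphere $\mathbb S^2$ of $\mathbb R^3\subset\mathbb H$ (so $\mathbf i^2=-1$), the restriction of $f$ to $\mathbb B^4(0,1)\cap\{x+\mathbf iy\mid x,y\in\mathbb R\}$ satisfies $\frac12\big(\frac\partial{\partial x}+\mathbf i\frac\partial{\partial y}\big)f=0$; each such $f$ has an expansion $f(x)=\sum_{n\ge0}x^na_n$ with $a_n\in\mathbb H$. The Fueter operator is $\mathcal D[f]=\sum_{k=0}^3\mathbf e_k\,\partial f/\partial x_k$, and $\mathcal M(\Omega)=\mathrm{Ker}(\mathcal D)\cap C^1(\Omega,\mathbb H)$ is the right module of hyperholomorphic functions on $\Omega$. For $y\in\mathbb H\setminus\{0\}$ let $K(y)=\frac1{2\pi^2}\frac{\overline y}{|y|^4}$ and $\mathcal T[g](x)=\int_{\mathbb B^4(0,1)}K(x-y)\,g(y)\,dy$, with $dy$ Lebesgue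 measure on $\mathbb R^4$. With this normalization $\mathcal D\circ\mathcal T[g]=g$. In $\mathcal T[\,\cdot\,]$ the expression inside the brackets is regarded as a function of $x\in\mathbb B^4(0,1)$. *)

theory Defs
  imports "HOL-Analysis.Analysis"
begin

section \<open>The skew field of real quaternions\<close>

datatype quat = Quat (qRe: real) (qIm1: real) (qIm2: real) (qIm3: real)

lemma quat_eqI:
  "qRe x = qRe y \<Longrightarrow> qIm1 x = qIm1 y \<Longrightarrow> qIm2 x = qIm2 y \<Longrightarrow> qIm3 x = qIm3 y \<Longrightarrow> x = y"
  by (cases x; cases y) simp

lemma quat_eq_iff:
  "x = y \<longleftrightarrow> qRe x = qRe y \<and> qIm1 x = qIm1 y \<and> qIm2 x = qIm2 y \<and> qIm3 x = qIm3 y"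
  by (auto intro: quat_eqI)

instantiation quat :: ab_group_add
begin

definition "0 = Quat 0 0 0 0"
definition "x + y = Quat (qRe x + qRe y) (qIm1 x + qIm1 y) (qIm2 x + qIm2 y) (qIm3 x + qIm3 y)"
definition "- x = Quat (- qRe x) (- qIm1 x) (- qIm2 x) (- qIm3 x)"
definition "x - y = Quat (qRe x - qRe y) (qIm1 x - qIm1 y) (qIm2 x - qIm2 y) (qIm3 x - qIm3 y)"

instance
  by standard
    (simp_all add: zero_quat_def plus_quat_def uminus_quat_def minus_quat_def)

end

lemma quat_add_simps [simp]:
  "qRe 0 = 0" "qIm1 0 = 0" "qIm2 0 = 0" "qIm3 0 = 0"
  "qRe (x + y) = qRe x + qRe y" "qIm1 (x + y) = qIm1 x + qIm1 y"
  "qIm2 (x + y) = qIm2 x + qIm2 y" "qIm3 (x + y) = qIm3 x + qIm3 y"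
  "qRe (- x) = - qRe x" "qIm1 (- x) = - qIm1 x" "qIm2 (- x) = - qIm2 x" "qIm3 (- x) = - qIm3 x"
  "qRe (x - y) = qRe x - qRe y" "qIm1 (x - y) = qIm1 x - qIm1 y"
  "qIm2 (x - y) = qIm2 x - qIm2 y" "qIm3 (x - y) = qIm3 x - qIm3 y"
  by (simp_all add: zero_quat_def plus_quat_def uminus_quat_def minus_quat_def)

instantiation quat :: real_vector
begin

definition "r *\<^sub>R x = Quat (r * qRe x) (r * qIm1 x) (r * qIm2 x) (r * qIm3 x)"

instance
  by standard (simp_all add: scaleR_quat_def quat_eq_iff algebra_simps)

end

lemma quat_scaleR_simps [simp]:
  "qRe (r *\<^sub>R x) = r * qRe x" "qIm1 (r *\<^sub>R x) = r * qIm1 x"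
  "qIm2 (r *\<^sub>R x) = r * qIm2 x" "qIm3 (r *\<^sub>R x) = r * qIm3 x"
  by (simp_all add: scaleR_quat_def)

instantiation quat :: real_algebra_1
begin

definition "1 = Quat 1 0 0 0"
definition "x * y = Quat
  (qRe x * qRe y - qIm1 x * qIm1 y - qIm2 x * qIm2 y - qIm3 x * qIm3 y)
  (qRe x * qIm1 y + qIm1 x * qRe y + qIm2 x * qIm3 y - qIm3 x * qIm2 y)
  (qRe x * qIm2 y - qIm1 x * qIm3 y + qIm2 x * qRe y + qIm3 x * qIm1 y)
  (qRe x * qIm3 y + qIm1 x * qIm2 y - qIm2 x * qIm1 y + qIm3 x * qRe y)"

instance
  by standard (simp_all add: one_quat_def times_quat_def quat_eq_iff algebra_simps)

end

lemma quat_mult_simps [simp]: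
  "qRe 1 = 1" "qIm1 1 = 0" "qIm2 1 = 0" "qIm3 1 = 0"
  "qRe (x * y) = qRe x * qRe y - qIm1 x * qIm1 y - qIm2 x * qIm2 y - qIm3 x * qIm3 y"
  "qIm1 (x * y) = qRe x * qIm1 y + qIm1 x * qRe y + qIm2 x * qIm3 y - qIm3 x * qIm2 y"
  "qIm2 (x * y) = qRe x * qIm2 y - qIm1 x * qIm3 y + qIm2 x * qRe y + qIm3 x * qIm1 y"
  "qIm3 (x * y) = qRe x * qIm3 y + qIm1 x * qIm2 y - qIm2 x * qIm1 y + qIm3 x * qRe y"
  by (simp_all add: one_quat_def times_quat_def)

instantiation quat :: real_inner
begin

definition "x \<bullet> y = qRe x * qRe y + qIm1 x * qIm1 y + qIm2 x * qIm2 y + qIm3 x * qIm3 y"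
definition "norm (x :: quat) = sqrt (x \<bullet> x)"
definition "sgn (x :: quat) = x /\<^sub>R norm x"
definition "dist (x :: quat) y = norm (x - y)"
definition [code del]:
  "(uniformity :: (quat \<times> quat) filter) = (INF e\<in>{0 <..}. principal {(x, y). dist x y < e})"
definition [code del]:
  "open (U :: quat set) \<longleftrightarrow> (\<forall>x\<in>U. eventually (\<lambda>(x', y). x' = x \<longrightarrow> y \<in> U) uniformity)"

instance
proof
  fix x y z :: quat and r :: real
  show "x \<bullet> y = y \<bullet> x" "(x + y) \<bullet> z = x \<bullet> z + y \<bullet> z" "r *\<^sub>R x \<bullet> y = r * (x \<bullet> y)"
    by (simp_all add: inner_quat_def algebra_simps)
  show "0 \<le> x \<bullet> x"
    by (simp add: inner_quat_def)
  show "x \<bullet> x = 0 \<longleftrightarrow> x = 0"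
    by (auto simp: inner_quat_def quat_eq_iff add_nonneg_eq_0_iff)
qed (simp_all add: norm_quat_def sgn_quat_def dist_quat_def uniformity_quat_def open_quat_def)

end

lemma norm_quat: "norm x = sqrt ((qRe x)\<^sup>2 + (qIm1 x)\<^sup>2 + (qIm2 x)\<^sup>2 + (qIm3 x)\<^sup>2)"
  by (simp add: norm_quat_def inner_quat_def power2_eq_square)

definition qcnj :: "quat \<Rightarrow> quat"
  where "qcnj x = Quat (qRe x) (- qIm1 x) (- qIm2 x) (- qIm3 x)"

definition qvec :: "quat \<Rightarrow> quat"
  where "qvec x = Quat 0 (qIm1 x) (qIm2 x) (qIm3 x)"

lemma quat_cnj_vec_simps [simp]:
  "qRe (qcnj x) = qRe x" "qIm1 (qcnj x) = - qIm1 x" "qIm2 (qcnj x) = - qIm2 x" "qIm3 (qcnj x) = - qIm3 x"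
  "qRe (qvec x) = 0" "qIm1 (qvec x) = qIm1 x" "qIm2 (qvec x) = qIm2 x" "qIm3 (qvec x) = qIm3 x"
  by (simp_all add: qcnj_def qvec_def)

instantiation quat :: real_normed_div_algebra
begin

definition "inverse x = qcnj x /\<^sub>R (norm x)\<^sup>2"
definition "x div (y :: quat) = x * inverse y"

instance
proof
  fix x y :: quat
  have norm_sq: "(norm z)\<^sup>2 = qRe z * qRe z + qIm1 z * qIm1 z + qIm2 z * qIm2 z + qIm3 z * qIm3 z"
    for z :: quat
    by (simp add: power2_norm_eq_inner inner_quat_def)
  have "(norm (x * y))\<^sup>2 = (norm x)\<^sup>2 * (norm y)\<^sup>2"
    unfolding norm_sq quat_mult_simps by (simp add: algebra_simps)
  then have "(norm (x * y))\<^sup>2 = (norm x * norm y)\<^sup>2"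
    by (simp add: power_mult_distrib)
  then show "norm (x * y) = norm x * norm y"
    by (simp only: power2_eq_iff_nonneg norm_ge_zero mult_nonneg_nonneg)
  have qcnj: "qcnj x * x = (norm x)\<^sup>2 *\<^sub>R 1" "x * qcnj x = (norm x)\<^sup>2 *\<^sub>R 1"
    by (simp_all add: quat_eq_iff norm_sq mult.commute)
  assume "x \<noteq> 0"
  then show "inverse x * x = 1" "x * inverse x = 1"
    by (simp_all add: inverse_quat_def qcnj)
next
  fix x y :: quat
  show "x div y = x * inverse y" by (simp add: divide_quat_def)
  show "inverse (0 :: quat) = 0" by (simp add: inverse_quat_def)
qed

end

definition qe1 :: quat where "qe1 = Quat 0 1 0 0"
definition qe2 :: quat where "qe2 = Quat 0 0 1 0"
definition qe3 :: quat where "qe3 = Quat 0 0 0 1"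

lemma quat_e_simps [simp]:
  "qRe qe1 = 0" "qIm1 qe1 = 1" "qIm2 qe1 = 0" "qIm3 qe1 = 0"
  "qRe qe2 = 0" "qIm1 qe2 = 0" "qIm2 qe2 = 1" "qIm3 qe2 = 0"
  "qRe qe3 = 0" "qIm1 qe3 = 0" "qIm2 qe3 = 0" "qIm3 qe3 = 1"
  by (simp_all add: qe1_def qe2_def qe3_def)

lemma quat_e_mult:
  "qe1 * qe1 = -1" "qe2 * qe2 = -1" "qe3 * qe3 = -1" "qe1 * qe2 * qe3 = -1"
  by (simp_all add: quat_eq_iff)

text \<open>The orthonormal basis \<open>1, e\<^sub>1, e\<^sub>2, e\<^sub>3\<close> identifies the quaternions with the Euclidean
  space of dimension four; in particular \<^const>\<open>lborel\<close> on \<^typ>\<open>quat\<close> is four-dimensional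
  Lebesgue measure.\<close>

instantiation quat :: euclidean_space
begin

definition "Basis = {1, qe1, qe2, qe3}"

instance
proof
  show "(Basis :: quat set) \<noteq> {}" "finite (Basis :: quat set)"
    by (simp_all add: Basis_quat_def)
  fix u v :: quat
  assume "u \<in> Basis" "v \<in> Basis"
  then show "u \<bullet> v = (if u = v then 1 else 0)"
    unfolding Basis_quat_def insert_iff empty_iff
    by (elim disjE) (simp_all add: inner_quat_def quat_eq_iff [of qe1]
        quat_eq_iff [of qe2] quat_eq_iff [of qe3] quat_eq_iff [of 1])
next
  fix x :: quat
  show "(\<forall>u\<in>Basis. x \<bullet> u = 0) \<longleftrightarrow> x = 0"
    by (simp add: Basis_quat_def inner_quat_def quat_eq_iff [of x])
qed

end

lemma DIM_quat: "DIM(quat) = 4"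
  by (simp add: Basis_quat_def quat_eq_iff [of 1] quat_eq_iff [of qe1] quat_eq_iff [of qe2])

lemma quat_expand:
  "x = of_real (qRe x) + qIm1 x *\<^sub>R qe1 + qIm2 x *\<^sub>R qe2 + qIm3 x *\<^sub>R qe3"
  by (rule quat_eqI) (simp_all add: of_real_def)

lemma qcnj_eq: "qcnj x = of_real (qRe x) - qvec x"
  by (rule quat_eqI) (simp_all add: of_real_def)

section \<open>Slice regular and hyperholomorphic functions\<close>

definition imag_units :: "quat set"
  where "imag_units = {i. qRe i = 0 \<and> norm i = 1}"

definition slice_regular :: "quat set \<Rightarrow> (quat \<Rightarrow> quat) set"
  where "slice_regular \<Omega> = {f.
    (\<forall>x\<in>\<Omega>. f differentiable (at x)) \<and>
    (\<forall>i\<in>imag_units. \<forall>x y :: real. of_real x + i * of_real y \<in> \<Omega> \<longrightarrow>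
      (1 / 2) *\<^sub>R
        (vector_derivative (\<lambda>s. f (of_real s + i * of_real y)) (at x) +
         i * vector_derivative (\<lambda>t. f (of_real x + i * of_real t)) (at y)) = 0)}"

definition partial_deriv :: "quat \<Rightarrow> (quat \<Rightarrow> quat) \<Rightarrow> quat \<Rightarrow> quat"
  where "partial_deriv e f x = vector_derivative (\<lambda>t. f (x + t *\<^sub>R e)) (at 0)"

definition fueter :: "(quat \<Rightarrow> quat) \<Rightarrow> quat \<Rightarrow> quat"
  where "fueter f x =
    partial_deriv 1 f x + qe1 * partial_deriv qe1 f x
      + qe2 * partial_deriv qe2 f x + qe3 * partial_deriv qe3 f x"

definition C1_on :: "quat set \<Rightarrow> (quat \<Rightarrow> quat) set"
  where "C1_on \<Omega> = {f. \<exists>f' :: quat \<Rightarrow> quat \<Rightarrow>\<^sub>L quat.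
    (\<forall>x\<in>\<Omega>. (f has_derivative blinfun_apply (f' x)) (at x)) \<and> continuous_on \<Omega> f'}"

definition hyperholomorphic :: "quat set \<Rightarrow> (quat \<Rightarrow> quat) set"
  where "hyperholomorphic \<Omega> = {f \<in> C1_on \<Omega>. \<forall>x\<in>\<Omega>. fueter f x = 0}"

section \<open>The Teodorescu operator on the unit ball\<close>

text \<open>The value at \<open>0\<close>, where the kernel is singular, is irrelevant: it only affects the integrand
  of \<open>teodorescu g x\<close> at the single point \<open>y = x\<close>.\<close>

definition cauchy_kernel :: "quat \<Rightarrow> quat"
  where "cauchy_kernel y = (1 / (2 * pi\<^sup>2)) *\<^sub>R (qcnj y /\<^sub>R norm y ^ 4)"

definition teodorescu :: "(quat \<Rightarrow> quat) \<Rightarrow> quat \<Rightarrow> quat"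
  where "teodorescu g x = (LINT y:ball 0 1|lborel. cauchy_kernel (x - y) * g y)"

definition xi :: "nat \<Rightarrow> quat \<Rightarrow> quat"
  where "xi n x =
    (if n = 0 then qvec x + 3 * teodorescu (\<lambda>_. 1) x
     else qvec x * x ^ n
       - 2 * (\<Sum>k=1..n. teodorescu (\<lambda>y. qvec y * qcnj y ^ (k - 1) * y ^ (n - k)) x)
       + 3 * teodorescu (\<lambda>y. y ^ n) x)"

end

theory Submission
  imports Defs
begin

text \<open>Put \<open>h\<^sub>n(x) = \<^bold>x x\<^sup>n\<close>, where \<open>\<^bold>x\<close> is the vector part of \<open>x\<close>. The proof rests on the identity
  \<open>D h\<^sub>n = 2 \<^bold>x \<Sum>\<^sub>k (cnj x)\<^bsup>k-1\<^esup> x\<^bsup>n-k\<^esup> - 3 x\<^sup>n\<close> (\<open>fueter_qvec_power\<close>), by which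
  \<open>\<xi>\<^sub>n = h\<^sub>n - T[D h\<^sub>n]\<close>. As the Teodorescu operator \<open>T\<close> is a right inverse of the Fueter
  operator \<open>D\<close>, every \<open>\<xi>\<^sub>n\<close> is hyperholomorphic. The partial sums of \<open>\<Sum> \<xi>\<^sub>n a\<^sub>n\<close> converge
  locally uniformly: the part \<open>\<Sum> \<^bold>x x\<^sup>n a\<^sub>n\<close> does because it is \<open>\<^bold>x\<close> times a convergent power
  series, the remaining part does by hypothesis. A locally uniform limit of hyperholomorphic functions
  is hyperholomorphic, which is the theorem.

  Both analytic facts, that \<open>h - T[D h]\<close> is hyperholomorphic and that limits are, are obtained
  without surface integrals, from one representation formula and one regularity statement.

  The formula (\<open>cauchy_pompeiu_compact_support\<close>) is \<open>u(x) = \<integral> K(x - y) (D u)(y) dy\<close> for \<open>u\<close> of class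
  \<open>C\<^sup>1\<close> with compact support. To prove it, the Cauchy kernel \<open>K\<close> is replaced by the Lipschitz
  kernel \<open>K\<^sub>\<epsilon>(z) = (2 \<pi>\<^sup>2)\<^bsup>-1\<^esup> cnj z / max (|z|, \<epsilon>)\<^sup>4\<close>. The Fueter operator applied to \<open>K\<^sub>\<epsilon>\<close> from
  the right gives exactly the indicator of the ball of radius \<open>\<epsilon>\<close> divided by its volume.
  Integration by parts therefore turns the integral of \<open>K\<^sub>\<epsilon>(x - y) (D u)(y)\<close> into the mean of \<open>u\<close>
  over that ball, and \<open>\<epsilon>\<close> tends to \<open>0\<close>.

  The regularity statement (\<open>kernel_potential_hyperholomorphic\<close>) says that, for an integrable \<open>w\<close> with
  bounded support, \<open>\<integral> K(x - y) w(y) dy\<close> is hyperholomorphic in any ball around \<open>0\<close> on which \<open>w\<close>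
  vanishes: the integral avoids the singularity of \<open>K\<close>, so
  it may be differentiated under the integral sign, and \<open>D K = 0\<close> away from \<open>0\<close>.

  Now let \<open>\<phi>\<close> be a cutoff function that is \<open>1\<close> on the ball of radius \<open>r < 1\<close> and has compact support in
  the unit ball. For \<open>|x| < r\<close> the formula for \<open>u = \<phi> h\<close> gives
  \<open>(h - T[D h])(x) = \<integral> K(x - y) w(y) dy\<close> with \<open>w = D(\<phi> h) - D h\<close> on the unit ball, which vanishes for
  \<open>|y| < r\<close>. Likewise, if \<open>D F = 0\<close>, then \<open>D(\<phi> F) = (D \<phi>) F\<close>, so
  \<open>F(x) = \<integral> K(x - y) (D \<phi>)(y) F(y) dy\<close>; this formula contains no derivative of \<open>F\<close>, hence survives
  uniform limits, and its right-hand side is again an integral of the regular kind.\<close>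

section \<open>Derivatives and the Fueter operator\<close>

text \<open>The Fueter operator as a function of the total derivative at a point rather than of the map, so that
  its value can be computed from any formula for the derivative.\<close>

definition fueter_symbol :: "(quat \<Rightarrow> quat) \<Rightarrow> quat"
  where "fueter_symbol D = D 1 + qe1 * D qe1 + qe2 * D qe2 + qe3 * D qe3"

lemma fueter_eq_symbol:
  assumes "(f has_derivative D) (at x)"
  shows "fueter f x = fueter_symbol D"
proof -
  have "partial_deriv e f x = D e" for e
  proof -
    have 1: "((\<lambda>t. x + t *\<^sub>R e) has_derivative (\<lambda>t. t *\<^sub>R e)) (at 0)"
      by (auto intro!: derivative_eq_intros)
    have "((\<lambda>t. f (x + t *\<^sub>R e)) has_derivative (\<lambda>t. D (t *\<^sub>R e))) (at 0)"
      by (rule has_derivative_compose[OF 1]) (use assms in simp)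
    moreover have "D (t *\<^sub>R e) = t *\<^sub>R D e" for t
      using has_derivative_bounded_linear[OF assms]
      by (simp add: linear_simps(5))
    ultimately have "((\<lambda>t. f (x + t *\<^sub>R e)) has_vector_derivative D e) (at 0)"
      by (simp add: has_vector_derivative_def)
    then show ?thesis
      by (simp add: partial_deriv_def vector_derivative_at)
  qed
  then show ?thesis
    by (simp add: fueter_def fueter_symbol_def)
qed

text \<open>In finite dimension the operator norm is controlled by the values on a basis, so continuity of the
  derivative can be checked in one direction \<open>h\<close> at a time.\<close>

lemma C1_onI:
  assumes D: "\<And>x. x \<in> S \<Longrightarrow> (f has_derivative D x) (at x)"
    and cont: "\<And>h. continuous_on S (\<lambda>x. D x h)"
  shows "f \<in> C1_on S"
  unfolding C1_on_def mem_Collect_eq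
proof (intro exI conjI ballI)
  have app: "blinfun_apply (Blinfun (D x)) = D x" if "x \<in> S" for x
    using D[OF that] by (intro bounded_linear_Blinfun_apply has_derivative_bounded_linear)
  show "(f has_derivative blinfun_apply (Blinfun (D x))) (at x)" if "x \<in> S" for x
    using D[OF that] app[OF that] by simp
  show "continuous_on S (\<lambda>x. Blinfun (D x))"
    unfolding continuous_on_eq_continuous_within
  proof (intro ballI continuous_blinfun_componentwiseI1)
    fix x i assume "x \<in> S"
    have "continuous_on S (\<lambda>x. blinfun_apply (Blinfun (D x)) i)"
      using cont[of i] by (rule continuous_on_eq) (simp add: app)
    then show "continuous (at x within S) (\<lambda>x. blinfun_apply (Blinfun (D x)) i)"
      using \<open>x \<in> S\<close> by (simp add: continuous_on_eq_continuous_within)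
  qed
qed

lemma C1_on_imp_continuous_on: "f \<in> C1_on S \<Longrightarrow> continuous_on S f"
  unfolding C1_on_def
  by (auto intro!: continuous_at_imp_continuous_on intro: has_derivative_continuous)

lemma C1_on_mult:
  assumes "f \<in> C1_on S" "g \<in> C1_on S"
  shows "(\<lambda>x. f x * g x) \<in> C1_on S"
proof -
  obtain f' g' :: "quat \<Rightarrow> quat \<Rightarrow>\<^sub>L quat"
    where f: "\<And>x. x \<in> S \<Longrightarrow> (f has_derivative f' x) (at x)" "continuous_on S f'"
      and g: "\<And>x. x \<in> S \<Longrightarrow> (g has_derivative g' x) (at x)" "continuous_on S g'"
    using assms by (auto simp: C1_on_def)
  show ?thesis
  proof (rule C1_onI)
    show "((\<lambda>x. f x * g x) has_derivative (\<lambda>h. f x * g' x h + f' x h * g x)) (at x)"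
      if "x \<in> S" for x
      using f(1)[OF that] g(1)[OF that] by (rule has_derivative_mult)
    show "continuous_on S (\<lambda>x. f x * g' x h + f' x h * g x)" for h
      by (intro continuous_intros f g assms C1_on_imp_continuous_on)
  qed
qed

lemma C1_on_linear:
  assumes "bounded_linear f"
  shows "f \<in> C1_on S"
proof (rule C1_onI[where D="\<lambda>_. f"])
  show "(f has_derivative f) (at x)" for x
    using assms by (rule bounded_linear_imp_has_derivative)
  show "continuous_on S (\<lambda>x. f h)" for h
    by (rule continuous_on_const)
qed

lemma continuous_on_fueter:
  assumes "f \<in> C1_on S"
  shows "continuous_on S (fueter f)"
proof -
  obtain f' :: "quat \<Rightarrow> quat \<Rightarrow>\<^sub>L quat"
    where f: "\<And>x. x \<in> S \<Longrightarrow> (f has_derivative f' x) (at x)" "continuous_on S f'"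
    using assms by (auto simp: C1_on_def)
  have "continuous_on S (\<lambda>x. fueter_symbol (f' x))"
    unfolding fueter_symbol_def by (intro continuous_intros f)
  then show ?thesis
    by (rule continuous_on_eq) (simp add: fueter_eq_symbol[OF f(1)])
qed

lemma quat_numeral_simps [simp]:
  "qRe (numeral k) = numeral k" "qIm1 (numeral k) = 0"
  "qIm2 (numeral k) = 0" "qIm3 (numeral k) = 0"
proof -
  have "numeral k = numeral k *\<^sub>R (1::quat)"
    by (simp add: scaleR_conv_of_real)
  then show "qRe (numeral k) = numeral k" "qIm1 (numeral k) = 0"
    "qIm2 (numeral k) = 0" "qIm3 (numeral k) = 0"
    by (metis quat_scaleR_simps quat_mult_simps mult_1_right mult_zero_right)+
qed

lemma norm_qcnj [simp]: "norm (qcnj x) = norm x"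
  by (simp add: norm_quat)

lemma bounded_linear_qcnj: "bounded_linear qcnj"
  by (rule bounded_linear_intro[where K=1]) (auto simp: quat_eq_iff)

lemma bounded_linear_qvec: "bounded_linear qvec"
proof (rule bounded_linear_intro[where K=1])
  show "norm (qvec x) \<le> norm x * 1" for x
    by (simp add: norm_quat)
qed (auto simp: quat_eq_iff)

lemma qcnj_mult: "qcnj (x * y) = qcnj y * qcnj x"
  by (simp add: quat_eq_iff)

lemma qcnj_power: "qcnj (x ^ n) = qcnj x ^ n"
proof (induction n)
  case (Suc n)
  then show ?case by (simp add: qcnj_mult power_commutes)
qed (simp add: quat_eq_iff)

lemma mult_qcnj: "x * qcnj x = (norm x)\<^sup>2 *\<^sub>R 1" "qcnj x * x = (norm x)\<^sup>2 *\<^sub>R 1"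
  by (simp_all add: quat_eq_iff power2_norm_eq_inner inner_quat_def)

text \<open>The sum \<open>q + e\<^sub>1 q e\<^sub>1 + e\<^sub>2 q e\<^sub>2 + e\<^sub>3 q e\<^sub>3\<close> keeps the vector part of \<open>q\<close> up to the factor \<open>2\<close> and maps
  the real part to \<open>-2\<close> times itself; it replaces commutativity in the product rule below.\<close>

lemma fueter_symbol_mult_left:
  "fueter_symbol (\<lambda>e. q * e) = - 2 *\<^sub>R qcnj q"
  by (simp add: fueter_symbol_def quat_eq_iff)

text \<open>Multiplying by \<open>x\<close> from the right is the one product for which the Leibniz rule of the
  noncommutative operator \<open>D\<close> has a simple error term. This makes \<open>D(\<^bold>x x\<^sup>n)\<close> accessible by
  induction, without the partial derivatives of \<open>x\<^sup>n\<close>.\<close>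

lemma fueter_mult_self:
  assumes "(f has_derivative D) (at x)"
  shows "fueter (\<lambda>x. f x * x) x = fueter f x * x - 2 *\<^sub>R qcnj (f x)"
proof -
  have "((\<lambda>x. f x * x) has_derivative (\<lambda>h. f x * h + D h * x)) (at x)"
    by (rule has_derivative_mult[OF assms has_derivative_ident])
  then have "fueter (\<lambda>x. f x * x) x = fueter_symbol (\<lambda>h. f x * h) + fueter_symbol D * x"
    by (simp add: fueter_eq_symbol fueter_symbol_def algebra_simps)
  then show ?thesis
    using assms by (simp add: fueter_symbol_mult_left fueter_eq_symbol)
qed

lemma C1_on_qvec_power: "(\<lambda>x. qvec x * x ^ n) \<in> C1_on S"
proof (induction n)
  case 0
  then show ?case by (simp add: C1_on_linear bounded_linear_qvec)
next
  case (Suc n)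
  have "(\<lambda>x. qvec x * x ^ n * x) \<in> C1_on S"
    by (rule C1_on_mult[OF Suc]) (rule C1_on_linear, rule bounded_linear_ident)
  then show ?case
    by (simp add: power_commutes mult.assoc)
qed

lemma qvec_qcnj_commute: "qvec x * qcnj x ^ n = qcnj x ^ n * qvec x"
proof -
  have "qvec x * qcnj x = qcnj x * qvec x"
    by (simp add: quat_eq_iff)
  then show ?thesis
    by (metis power_commuting_commutes)
qed

text \<open>The integrand in the hypothesis of the theorem is the negative of this expression. In the induction step
  the error term of \<open>fueter_mult_self\<close> contributes the new summand \<open>k = n + 1\<close>, because \<open>\<^bold>x\<close>
  commutes with the conjugate of \<open>x\<close>.\<close>

lemma fueter_qvec_power:
  "fueter (\<lambda>x. qvec x * x ^ n) x =
    2 * qvec x * (\<Sum>k=1..n. qcnj x ^ (k - 1) * x ^ (n - k)) - 3 * x ^ n"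
proof (induction n)
  case 0
  have "fueter qvec x = fueter_symbol qvec"
    by (intro fueter_eq_symbol bounded_linear_imp_has_derivative bounded_linear_qvec)
  also have "\<dots> = -3"
    by (simp add: fueter_symbol_def quat_eq_iff)
  finally show ?case by simp
next
  case (Suc n)
  obtain D where D: "((\<lambda>x. qvec x * x ^ n) has_derivative D) (at x)"
    using C1_on_qvec_power[of n UNIV] by (auto simp: C1_on_def)
  have "fueter (\<lambda>x. qvec x * x ^ Suc n) x = fueter (\<lambda>x. qvec x * x ^ n * x) x"
    by (simp add: power_commutes mult.assoc)
  also have "\<dots> = fueter (\<lambda>x. qvec x * x ^ n) x * x - 2 *\<^sub>R (qcnj x ^ n * qcnj (qvec x))"
    by (simp add: fueter_mult_self[OF D] qcnj_mult qcnj_power)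
  also have "qcnj (qvec x) = - qvec x"
    by (simp add: quat_eq_iff)
  finally have "fueter (\<lambda>x. qvec x * x ^ Suc n) x =
      2 * qvec x * (\<Sum>k=1..n. qcnj x ^ (k - 1) * x ^ (n - k)) * x
        + 2 * qvec x * qcnj x ^ n - 3 * x ^ Suc n"
    by (simp only: Suc) (simp add: algebra_simps power_commutes scaleR_2 mult_2 qvec_qcnj_commute)
  moreover have "(\<Sum>k=1..n. qcnj x ^ (k - 1) * x ^ (n - k)) * x =
      (\<Sum>k=1..n. qcnj x ^ (k - 1) * x ^ (Suc n - k))"
    unfolding sum_distrib_right
    by (rule sum.cong) (auto simp: mult.assoc power_commutes Suc_diff_le)
  ultimately show ?case
    by (simp add: distrib_left mult.assoc)
qed

section \<open>Integration tools\<close>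

text \<open>Integration by parts without Fubini: by translation invariance the difference quotients of \<open>\<phi>\<close> have
  integral \<open>0\<close>, and the Lipschitz bound dominates them. Only almost everywhere differentiability is
  required, so that kernels with a kink on a sphere are allowed.\<close>

lemma integral_directional_derivative_eq_0:
  fixes \<phi> \<psi> :: "'a::euclidean_space \<Rightarrow> 'b::{banach, second_countable_topology}"
  assumes lip: "\<And>x y. norm (\<phi> x - \<phi> y) \<le> L * norm (x - y)"
    and supp: "\<And>x. norm x \<ge> R \<Longrightarrow> \<phi> x = 0"
    and deriv: "AE x in lborel. ((\<lambda>t. \<phi> (x + t *\<^sub>R e)) has_vector_derivative \<psi> x) (at 0)"
    and [measurable]: "\<psi> \<in> borel_measurable borel"
  shows "has_bochner_integral lborel \<psi> 0"
proof -
  define t :: "nat \<Rightarrow> real" where "t n = inverse (real (Suc n))" for n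
  have t: "t n > 0" "t n \<le> 1" for n
    by (simp_all add: t_def inverse_le_1_iff)
  define s where "s n x = (\<phi> (x + t n *\<^sub>R e) - \<phi> x) /\<^sub>R t n" for n x
  have "continuous_on UNIV \<phi>"
  proof (rule lipschitz_on_continuous_on[where L="max L 0"], rule lipschitz_onI)
    show "dist (\<phi> x) (\<phi> y) \<le> max L 0 * dist x y" for x y
      unfolding dist_norm
      by (rule order_trans[OF lip]) (intro mult_right_mono, auto)
  qed simp
  then have [measurable]: "\<phi> \<in> borel_measurable borel"
    by (rule borel_measurable_continuous_onI)
  have [measurable]: "s n \<in> borel_measurable borel" for n
    unfolding s_def by measurable
  have lim: "AE x in lborel. (\<lambda>n. s n x) \<longlonglongrightarrow> \<psi> x"
    using deriv
  proof eventually_elim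
    fix x assume "((\<lambda>t. \<phi> (x + t *\<^sub>R e)) has_vector_derivative \<psi> x) (at 0)"
    then have "(\<lambda>h. norm (\<phi> (x + h *\<^sub>R e) - \<phi> x - h *\<^sub>R \<psi> x) / norm h) \<midarrow>0\<rightarrow> 0"
      by (simp add: has_vector_derivative_def has_derivative_at)
    moreover have "filterlim t (at 0) sequentially"
      unfolding filterlim_at t_def using LIMSEQ_inverse_real_of_nat by auto
    ultimately have "(\<lambda>n. norm (\<phi> (x + t n *\<^sub>R e) - \<phi> x - t n *\<^sub>R \<psi> x) / norm (t n)) \<longlonglongrightarrow> 0"
      by (rule filterlim_compose)
    moreover have "norm (\<phi> (x + t n *\<^sub>R e) - \<phi> x - t n *\<^sub>R \<psi> x) / norm (t n) = norm (s n x - \<psi> x)" for n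
    proof -
      have "s n x - \<psi> x = (\<phi> (x + t n *\<^sub>R e) - \<phi> x - t n *\<^sub>R \<psi> x) /\<^sub>R t n"
        using t(1)[of n] by (simp add: s_def scaleR_diff_right)
      then show ?thesis by (simp add: divide_inverse mult.commute)
    qed
    ultimately show "(\<lambda>n. s n x) \<longlonglongrightarrow> \<psi> x"
      by (simp add: LIM_zero_iff tendsto_norm_zero_iff)
  qed
  have bound: "norm (s n x) \<le> indicator (ball 0 (R + norm e)) x * (L * norm e)" for n x
  proof (cases "x \<in> ball 0 (R + norm e)")
    case True
    have "norm (\<phi> (x + t n *\<^sub>R e) - \<phi> x) \<le> L * (t n * norm e)"
      using lip[of "x + t n *\<^sub>R e" x] t[of n] by simp
    then have "norm (s n x) \<le> L * norm e"
      using t(1)[of n] unfolding s_def norm_scaleR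
      by (simp add: pos_divide_le_eq divide_inverse_commute [symmetric] algebra_simps)
    then show ?thesis
      using True by simp
  next
    case False
    have "norm x - t n * norm e \<le> norm (x + t n *\<^sub>R e)"
      using norm_triangle_ineq2[of x "- t n *\<^sub>R e"] t(1)[of n] by simp
    moreover have "t n * norm e \<le> norm e"
      using t[of n] by (simp add: mult_left_le_one_le)
    moreover have "norm x \<ge> R + norm e"
      using False by simp
    moreover have "norm e \<ge> 0"
      by simp
    ultimately have "\<phi> x = 0" "\<phi> (x + t n *\<^sub>R e) = 0"
      by (intro supp, linarith)+
    then show ?thesis
      using False by (simp add: s_def)
  qed
  have int\<phi>: "integrable lborel \<phi>"
  proof (rule Bochner_Integration.integrable_bound)
    show "integrable lborel (\<lambda>x. indicator (ball 0 R) x * (norm (\<phi> 0) + \<bar>L\<bar> * R) :: real)"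
      by (intro integrable_mult_left integrable_real_indicator emeasure_lborel_ball_finite) simp_all
    show "AE x in lborel. norm (\<phi> x) \<le> norm (indicator (ball 0 R) x * (norm (\<phi> 0) + \<bar>L\<bar> * R))"
    proof (rule AE_I2)
      fix x
      show "norm (\<phi> x) \<le> norm (indicator (ball 0 R) x * (norm (\<phi> 0) + \<bar>L\<bar> * R))"
      proof (cases "norm x < R")
        case True
        have "norm (\<phi> x) \<le> norm (\<phi> 0) + norm (\<phi> x - \<phi> 0)"
          using norm_triangle_ineq2[of "\<phi> x" "\<phi> 0"] by simp
        also have "\<dots> \<le> norm (\<phi> 0) + L * norm x"
          using lip[of x 0] by simp
        also have "L * norm x \<le> \<bar>L\<bar> * R"
          using True by (intro mult_mono) auto
        finally show ?thesis
          using True by (simp add: abs_if)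
      next
        case False
        then show ?thesis by (simp add: supp)
      qed
    qed
  qed simp
  have s0: "integral\<^sup>L lborel (s n) = 0" for n
  proof -
    have 1: "integrable lborel (\<lambda>x. \<phi> (t n *\<^sub>R e + x))"
      by (subst integrable_distr_eq[symmetric, where N=borel and M = lborel]) 
         (simp_all add: int\<phi> lborel_distr_plus)
    have 2: "(LINT x|lborel. \<phi> (t n *\<^sub>R e + x)) = integral\<^sup>L lborel \<phi>"
      by (subst integral_distr[symmetric, where N=borel]) (simp_all add: lborel_distr_plus)
    have "integral\<^sup>L lborel (s n) = (LINT x|lborel. \<phi> (t n *\<^sub>R e + x) - \<phi> x) /\<^sub>R t n"
      unfolding s_def by (subst integral_scaleR_right) (simp add: add.commute)
    then show ?thesis
      using 1 2 int\<phi> by simp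
  qed
  have dom: "integrable lborel (\<lambda>x. indicator (ball 0 (R + norm e)) x * (L * norm e) :: real)"
    by (intro integrable_mult_left integrable_real_indicator emeasure_lborel_ball_finite) simp_all
  have "integrable lborel \<psi>" 
    by (rule integrable_dominated_convergence[OF _ _ dom lim]) (use bound in auto)
  moreover have "(\<lambda>n. integral\<^sup>L lborel (s n)) \<longlonglongrightarrow> integral\<^sup>L lborel \<psi>"
    by (rule integral_dominated_convergence[OF _ _ dom lim]) (use bound in auto)
  then have "integral\<^sup>L lborel \<psi> = 0"
    by (simp add: s0 LIMSEQ_const_iff)
  ultimately show ?thesis
    by (simp add: has_bochner_integral_iff)
qed

text \<open>Local integrability of \<open>|y|\<^bsup>-3\<^esup>\<close> in dimension four. The function is dominated by a sum of multiples of
  indicators of balls of radius \<open>R / 2\<^sup>k\<close>: on the dyadic shell at distance about \<open>R / 2\<^sup>k\<close> it is at most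
  \<open>8 \<cdot> 8\<^sup>k / R\<^sup>3\<close>, while the volume of the ball decays like \<open>16\<^bsup>-k\<^esup>\<close>, so that the integrals form a
  geometric series.\<close>

lemma integrable_inverse_norm_cube:
  fixes c :: quat
  shows "integrable lborel (\<lambda>y. indicator (ball c R) y / norm (c - y) ^ 3 :: real)"
proof (cases "R > 0")
  case False
  then have "ball c R = {}" by simp
  then have "(\<lambda>y. indicator (ball c R) y / norm (c - y) ^ 3 :: real) = (\<lambda>y. 0)"
    by (simp only: indicator_simps empty_iff) simp
  then show ?thesis by (simp only: Bochner_Integration.integrable_zero)
next
  case True
  define g where "g k y = (8 * 8 ^ k / R ^ 3) * indicator (ball c (R / 2 ^ k)) y" for k :: nat and y :: quat
  have [measurable]: "g k \<in> borel_measurable borel" for k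
    unfolding g_def by (intro borel_measurable_times borel_measurable_const borel_measurable_indicator) simp
  have le: "ennreal (indicator (ball c R) y / norm (c - y) ^ 3) \<le> (\<Sum>k. ennreal (g k y))" for y
  proof (cases "y \<in> ball c R \<and> y \<noteq> c")
    case False
    then show ?thesis by auto
  next
    case True
    define r where "r = norm (c - y)"
    have r: "0 < r" "r < R"
      using True by (auto simp: r_def dist_norm)
    obtain m where m: "(1/2) ^ m < r / R"
      using real_arch_pow_inv[of "r / R" "1/2"] r by auto
    \<comment> \<open>By minimality \<open>R / 2\<^sup>k \<le> r < R / 2\<^bsup>k-1\<^esup>\<close>, so the term with index \<open>k - 1\<close> alone suffices.\<close>
    define k where "k = (LEAST m. R / 2 ^ m \<le> r)"
    have ex: "R / 2 ^ m \<le> r"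
      using m r by (simp add: field_simps power_divide)
    then have k: "R / 2 ^ k \<le> r"
      unfolding k_def by (rule LeastI)
    have "k \<noteq> 0"
      using k r by (cases k) auto
    then obtain j where j: "k = Suc j"
      by (cases k) auto
    have "\<not> R / 2 ^ j \<le> r"
      using j not_less_Least[of j "\<lambda>m. R / 2 ^ m \<le> r"] by (simp add: k_def)
    then have "y \<in> ball c (R / 2 ^ j)"
      by (simp add: r_def dist_norm)
    then have "g j y = 8 * 8 ^ j / R ^ 3"
      by (simp add: g_def)
    also have "\<dots> = 1 / (R / 2 ^ k) ^ 3"
      using \<open>R > 0\<close> by (simp add: j power_divide power_mult_distrib field_simps flip: power_mult)
        (simp add: power_mult mult.commute[of j])
    also have "\<dots> \<ge> 1 / r ^ 3"
      using k r \<open>R > 0\<close> by (intro divide_left_mono power_mono) auto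
    finally have "indicator (ball c R) y / norm (c - y) ^ 3 \<le> g j y"
      using True by (simp add: r_def)
    then have "ennreal (indicator (ball c R) y / norm (c - y) ^ 3) \<le> ennreal (g j y)"
      by (rule ennreal_leI)
    also have "\<dots> \<le> (\<Sum>k. ennreal (g k y))"
      using sum_le_suminf[of "\<lambda>k. ennreal (g k y)" "{j}"] by simp
    finally show ?thesis .
  qed
  have "(\<integral>\<^sup>+y. ennreal (g k y) \<partial>lborel) = ennreal (4 * pi\<^sup>2 * R * (1/2) ^ k)" for k
  proof -
    have "(\<integral>\<^sup>+y. ennreal (g k y) \<partial>lborel) =
        ennreal (8 * 8 ^ k / R ^ 3) * emeasure lborel (ball c (R / 2 ^ k))"
    proof -
      have "ennreal (g k y) = ennreal (8 * 8 ^ k / R ^ 3) * indicator (ball c (R / 2 ^ k)) y" for y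
        by (simp add: g_def indicator_def)
      then show ?thesis
        by (simp only: nn_integral_cmult_indicator borel_open open_ball sets_lborel)
    qed
    also have "\<dots> = ennreal (8 * 8 ^ k / R ^ 3 * (pi\<^sup>2 / 2 * (R / 2 ^ k) ^ 4))"
      using True by (simp add: emeasure_ball DIM_quat unit_ball_vol_4 flip: ennreal_mult)
    also have "8 * 8 ^ k / R ^ 3 * (pi\<^sup>2 / 2 * (R / 2 ^ k) ^ 4) = 4 * pi\<^sup>2 * R * (1/2) ^ k"
    proof -
      have "(2 ^ k) ^ 4 = (8 ^ k * 2 ^ k :: real)"
        by (simp flip: power_mult power_mult_distrib) (simp add: power_mult mult.commute[of k])
      then show ?thesis
        using True by (simp add: power_divide field_simps power4_eq_xxxx power3_eq_cube)
    qed
    finally show ?thesis .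
  qed
  then have "(\<integral>\<^sup>+y. (\<Sum>k. ennreal (g k y)) \<partial>lborel) = (\<Sum>k. ennreal (4 * pi\<^sup>2 * R * (1/2) ^ k))"
    by (subst nn_integral_suminf) simp_all
  also have "\<dots> < \<infinity>"
    using True by (subst suminf_ennreal_eq[OF _ sums_mult[OF geometric_sums]]) auto
  finally have fin: "(\<integral>\<^sup>+y. (\<Sum>k. ennreal (g k y)) \<partial>lborel) < \<infinity>" .
  show ?thesis
  proof (rule integrableI_bounded)
    have "(\<integral>\<^sup>+y. ennreal (norm (indicator (ball c R) y / norm (c - y) ^ 3 :: real)) \<partial>lborel)
        \<le> (\<integral>\<^sup>+y. (\<Sum>k. ennreal (g k y)) \<partial>lborel)"
      using le by (intro nn_integral_mono) simp
    then show "(\<integral>\<^sup>+y. ennreal (norm (indicator (ball c R) y / norm (c - y) ^ 3 :: real)) \<partial>lborel) < \<infinity>"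
      using fin by (rule le_less_trans)
    show "(\<lambda>y. indicator (ball c R) y / norm (c - y) ^ 3 :: real) \<in> borel_measurable lborel"
    proof (intro borel_measurable_divide borel_measurable_indicator)
      have "(\<lambda>y. norm (c - y) ^ 3) \<in> borel_measurable borel"
        by (intro borel_measurable_continuous_onI continuous_intros)
      then show "(\<lambda>y. norm (c - y) ^ 3) \<in> borel_measurable lborel"
        by simp
    qed simp
  qed
qed

section \<open>The Cauchy kernel\<close>

definition kernel_deriv :: "quat \<Rightarrow> quat \<Rightarrow> quat"
  where "kernel_deriv z h = (1 / (2 * pi\<^sup>2)) *\<^sub>R
    (qcnj h /\<^sub>R norm z ^ 4 - (4 / norm z ^ 6 * (z \<bullet> h)) *\<^sub>R qcnj z)"

lemma has_derivative_cauchy_kernel: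
  assumes "z \<noteq> 0"
  shows "(cauchy_kernel has_derivative kernel_deriv z) (at z)"
proof -
  have q: "(qcnj has_derivative qcnj) (at z)"
    by (rule bounded_linear_imp_has_derivative[OF bounded_linear_qcnj])
  have n: "norm x ^ 4 = (x \<bullet> x)\<^sup>2" for x :: quat
    by (simp add: dot_square_norm power_mult[symmetric])
  have z: "z \<bullet> z \<noteq> 0"
    using assms by simp
  have i: "((\<lambda>x. inverse ((x \<bullet> x)\<^sup>2)) has_derivative
      (\<lambda>h. - (4 * (z \<bullet> h) / norm z ^ 6))) (at z)"
  proof -
    have "((\<lambda>x. inverse ((x \<bullet> x)\<^sup>2)) has_derivative
      (\<lambda>h. - (inverse ((z \<bullet> z)\<^sup>2) * (2 * (z \<bullet> z) * (2 * (z \<bullet> h))) * inverse ((z \<bullet> z)\<^sup>2)))) (at z)"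
      using z by (auto intro!: derivative_eq_intros simp: inner_commute algebra_simps)
    also have "(\<lambda>h. - (inverse ((z \<bullet> z)\<^sup>2) * (2 * (z \<bullet> z) * (2 * (z \<bullet> h))) * inverse ((z \<bullet> z)\<^sup>2))) =
       (\<lambda>h. - (4 * (z \<bullet> h) / norm z ^ 6))"
    proof
      fix h
      have "norm z ^ 6 = (z \<bullet> z) ^ 3"
        by (simp add: dot_square_norm power_mult[symmetric])
      then show "- (inverse ((z \<bullet> z)\<^sup>2) * (2 * (z \<bullet> z) * (2 * (z \<bullet> h))) * inverse ((z \<bullet> z)\<^sup>2)) =
       - (4 * (z \<bullet> h) / norm z ^ 6)"
        using z by (simp add: field_simps power2_eq_square power3_eq_cube)
    qed
    finally show ?thesis .
  qed
  have "((\<lambda>x. (1 / (2 * pi\<^sup>2)) *\<^sub>R (inverse ((x \<bullet> x)\<^sup>2) *\<^sub>R qcnj x)) has_derivative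
     (\<lambda>h. (1 / (2 * pi\<^sup>2)) *\<^sub>R (inverse ((z \<bullet> z)\<^sup>2) *\<^sub>R qcnj h + (- (4 * (z \<bullet> h) / norm z ^ 6)) *\<^sub>R qcnj z))) (at z)"
    by (intro has_derivative_scaleR_right has_derivative_scaleR i q)
  then show ?thesis
    by (simp add: cauchy_kernel_def[abs_def] kernel_deriv_def[abs_def] n)
qed

text \<open>Sorting of the terms in the left and right Fueter sums of a derivative of the form
  \<open>c (a cnj h - b (z \<bullet> h) cnj z)\<close>, with free variables in place of the values at \<open>1, e\<^sub>1, e\<^sub>2, e\<^sub>3\<close>.\<close>

lemma fueter_sums_of_kernel_shape:
  fixes p0 p1 p2 p3 w q :: quat
  shows "c *\<^sub>R (a *\<^sub>R p0 - (b * t0) *\<^sub>R w) * q + qe1 * (c *\<^sub>R (a *\<^sub>R p1 - (b * t1) *\<^sub>R w) * q)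
      + qe2 * (c *\<^sub>R (a *\<^sub>R p2 - (b * t2) *\<^sub>R w) * q) + qe3 * (c *\<^sub>R (a *\<^sub>R p3 - (b * t3) *\<^sub>R w) * q)
    = c *\<^sub>R (a *\<^sub>R (p0 + qe1 * p1 + qe2 * p2 + qe3 * p3)
        - b *\<^sub>R ((t0 *\<^sub>R 1 + t1 *\<^sub>R qe1 + t2 *\<^sub>R qe2 + t3 *\<^sub>R qe3) * w)) * q"
    and "c *\<^sub>R (a *\<^sub>R p0 - (b * t0) *\<^sub>R w) + c *\<^sub>R (a *\<^sub>R p1 - (b * t1) *\<^sub>R w) * qe1
      + c *\<^sub>R (a *\<^sub>R p2 - (b * t2) *\<^sub>R w) * qe2 + c *\<^sub>R (a *\<^sub>R p3 - (b * t3) *\<^sub>R w) * qe3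
    = c *\<^sub>R (a *\<^sub>R (p0 + p1 * qe1 + p2 * qe2 + p3 * qe3)
        - b *\<^sub>R (w * (t0 *\<^sub>R 1 + t1 *\<^sub>R qe1 + t2 *\<^sub>R qe2 + t3 *\<^sub>R qe3)))"
  by (simp_all add: algebra_simps)

text \<open>The exponent \<open>4\<close> in the kernel is the dimension: differentiating \<open>cnj z\<close> produces \<open>4\<close> terms, and
  differentiating \<open>|z|\<^bsup>-4\<^esup>\<close> produces the same amount with the opposite sign.\<close>

lemma kernel_coefficients_cancel:
  assumes "z \<noteq> (0::quat)"
  shows "(4::quat) /\<^sub>R norm z ^ 4 = (4 * (norm z)\<^sup>2 / norm z ^ 6) *\<^sub>R 1"
proof -
  have "norm z ^ 6 = norm z ^ 4 * (norm z)\<^sup>2"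
    by (simp flip: power_add)
  then show ?thesis
    using assms by (simp add: quat_eq_iff divide_simps)
qed

lemma fueter_kernel_deriv: "fueter_symbol (\<lambda>h. kernel_deriv z h * q) = 0"
proof (cases "z = 0")
  case True
  then show ?thesis by (simp add: fueter_symbol_def kernel_deriv_def)
next
  case False
  have "qcnj 1 + qe1 * qcnj qe1 + qe2 * qcnj qe2 + qe3 * qcnj qe3 = 4"
    by (simp add: quat_eq_iff)
  moreover have "(z \<bullet> 1) *\<^sub>R 1 + (z \<bullet> qe1) *\<^sub>R qe1 + (z \<bullet> qe2) *\<^sub>R qe2 + (z \<bullet> qe3) *\<^sub>R qe3 = z"
    by (simp add: quat_eq_iff inner_quat_def)
  moreover have "fueter_symbol (\<lambda>h. kernel_deriv z h * q) = (1 / (2 * pi\<^sup>2)) *\<^sub>R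
    ((qcnj 1 + qe1 * qcnj qe1 + qe2 * qcnj qe2 + qe3 * qcnj qe3) /\<^sub>R norm z ^ 4
     - (4 / norm z ^ 6) *\<^sub>R (((z \<bullet> 1) *\<^sub>R 1 + (z \<bullet> qe1) *\<^sub>R qe1 + (z \<bullet> qe2) *\<^sub>R qe2 + (z \<bullet> qe3) *\<^sub>R qe3) * qcnj z)) * q"
    unfolding fueter_symbol_def kernel_deriv_def by (rule fueter_sums_of_kernel_shape)
  ultimately show ?thesis
    using kernel_coefficients_cancel[OF False] by (simp add: mult_qcnj)
qed

lemma right_fueter_kernel_deriv:
  assumes "z \<noteq> 0"
  shows "kernel_deriv z 1 + kernel_deriv z qe1 * qe1 + kernel_deriv z qe2 * qe2 + kernel_deriv z qe3 * qe3 = 0"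
proof -
  have "qcnj 1 + qcnj qe1 * qe1 + qcnj qe2 * qe2 + qcnj qe3 * qe3 = 4"
    by (simp add: quat_eq_iff)
  moreover have "(z \<bullet> 1) *\<^sub>R 1 + (z \<bullet> qe1) *\<^sub>R qe1 + (z \<bullet> qe2) *\<^sub>R qe2 + (z \<bullet> qe3) *\<^sub>R qe3 = z"
    by (simp add: quat_eq_iff inner_quat_def)
  moreover have "kernel_deriv z 1 + kernel_deriv z qe1 * qe1 + kernel_deriv z qe2 * qe2 + kernel_deriv z qe3 * qe3 = (1 / (2 * pi\<^sup>2)) *\<^sub>R
    ((qcnj 1 + qcnj qe1 * qe1 + qcnj qe2 * qe2 + qcnj qe3 * qe3) /\<^sub>R norm z ^ 4
     - (4 / norm z ^ 6) *\<^sub>R (qcnj z * ((z \<bullet> 1) *\<^sub>R 1 + (z \<bullet> qe1) *\<^sub>R qe1 + (z \<bullet> qe2) *\<^sub>R qe2 + (z \<bullet> qe3) *\<^sub>R qe3)))"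
    unfolding kernel_deriv_def by (rule fueter_sums_of_kernel_shape)
  ultimately show ?thesis
    using kernel_coefficients_cancel[OF assms] by (simp add: mult_qcnj)
qed

lemma measurable_qcnj [measurable]: "qcnj \<in> borel_measurable borel"
  by (intro borel_measurable_continuous_onI linear_continuous_on bounded_linear_qcnj)

lemma measurable_cauchy_kernel [measurable]: "cauchy_kernel \<in> borel_measurable borel"
  unfolding cauchy_kernel_def by measurable

lemma measurable_kernel_deriv [measurable]: "(\<lambda>z. kernel_deriv z h) \<in> borel_measurable borel"
  unfolding kernel_deriv_def by measurable

lemma norm_cauchy_kernel: "norm (cauchy_kernel z) = 1 / (2 * pi\<^sup>2) / norm z ^ 3"
proof (cases "z = 0")
  case False
  have "norm z ^ 4 = norm z * norm z ^ 3"
    by (simp flip: power_Suc)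
  then show ?thesis
    using False by (simp add: cauchy_kernel_def divide_simps)
qed (simp add: cauchy_kernel_def)

lemma C1_on_cauchy_kernel: "cauchy_kernel \<in> C1_on (- {0})"
proof (rule C1_onI[where D=kernel_deriv])
  show "continuous_on (- {0}) (\<lambda>x. kernel_deriv x h)" for h
    unfolding kernel_deriv_def 
    by (intro continuous_intros linear_continuous_on bounded_linear_qcnj) auto
qed (simp add: has_derivative_cauchy_kernel)

lemma integrable_kernel_times:
  assumes [measurable]: "g \<in> borel_measurable lborel"
    and bound: "\<And>y. norm (g y) \<le> B" and supp: "\<And>y. y \<notin> ball x R \<Longrightarrow> g y = 0"
  shows "integrable lborel (\<lambda>y. cauchy_kernel (x - y) * g y)"
proof (rule Bochner_Integration.integrable_bound)
  show "integrable lborel (\<lambda>y. B / (2 * pi\<^sup>2) * (indicator (ball x R) y / norm (x - y) ^ 3))"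
    by (intro integrable_mult_right integrable_inverse_norm_cube)
  show "AE y in lborel. norm (cauchy_kernel (x - y) * g y)
      \<le> norm (B / (2 * pi\<^sup>2) * (indicator (ball x R) y / norm (x - y) ^ 3))"
  proof (rule AE_I2)
    fix y
    have "B \<ge> 0" using order_trans[OF norm_ge_zero bound] .
    then show "norm (cauchy_kernel (x - y) * g y)
      \<le> norm (B / (2 * pi\<^sup>2) * (indicator (ball x R) y / norm (x - y) ^ 3))"
      using bound[of y] supp[of y]
      by (cases "y \<in> ball x R")
        (auto simp: norm_mult norm_cauchy_kernel abs_mult intro!: divide_right_mono)
  qed
qed measurable

section \<open>The truncated Cauchy kernel\<close>

text \<open>Boundedness is included to make the notion stable under products.\<close>

definition bdd_lipschitz :: "('a::real_normed_vector \<Rightarrow> 'b::real_normed_vector) \<Rightarrow> bool"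
  where "bdd_lipschitz f \<longleftrightarrow>
    (\<exists>A L. (\<forall>x. norm (f x) \<le> A) \<and> (\<forall>x y. norm (f x - f y) \<le> L * norm (x - y)))"

lemma bdd_lipschitzI:
  "(\<And>x. norm (f x) \<le> A) \<Longrightarrow> (\<And>x y. norm (f x - f y) \<le> L * norm (x - y)) \<Longrightarrow> bdd_lipschitz f"
  by (auto simp: bdd_lipschitz_def)

lemma bdd_lipschitz_const: "bdd_lipschitz (\<lambda>_. c)"
  by (rule bdd_lipschitzI[of _ "norm c" 0]) auto

lemma bdd_lipschitz_bilinear:
  assumes "bounded_bilinear p" "bdd_lipschitz f" "bdd_lipschitz g"
  shows "bdd_lipschitz (\<lambda>x. p (f x) (g x))"
proof -
  interpret bounded_bilinear p by fact
  obtain K where K: "K \<ge> 0" "\<And>a b. norm (p a b) \<le> norm a * norm b * K"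
    using nonneg_bounded by blast
  obtain A L where f: "\<And>x. norm (f x) \<le> A" "\<And>x y. norm (f x - f y) \<le> L * norm (x - y)"
    using assms(2) by (auto simp: bdd_lipschitz_def)
  obtain B M where g: "\<And>x. norm (g x) \<le> B" "\<And>x y. norm (g x - g y) \<le> M * norm (x - y)"
    using assms(3) by (auto simp: bdd_lipschitz_def)
  have A: "A \<ge> 0" and B: "B \<ge> 0"
    using order_trans[OF norm_ge_zero f(1)] order_trans[OF norm_ge_zero g(1)] by auto
  show ?thesis
  proof (rule bdd_lipschitzI)
    show "norm (p (f x) (g x)) \<le> A * B * K" for x
      by (rule order_trans[OF K(2)]) (intro mult_right_mono mult_mono f g K A norm_ge_zero)
    show "norm (p (f x) (g x) - p (f y) (g y)) \<le> (A * M * K + L * B * K) * norm (x - y)" for x y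
    proof -
      have "p (f x) (g x) - p (f y) (g y) = p (f x) (g x - g y) + p (f x - f y) (g y)"
        by (simp add: diff_left diff_right)
      also have "norm \<dots> \<le> norm (f x) * norm (g x - g y) * K + norm (f x - f y) * norm (g y) * K"
        by (intro norm_triangle_mono K)
      also have "\<dots> \<le> A * (M * norm (x - y)) * K + L * norm (x - y) * B * K"
        by (intro add_mono mult_right_mono mult_mono f g K A norm_ge_zero
            order_trans[OF norm_ge_zero f(2)])
      finally show ?thesis by (simp add: algebra_simps)
    qed
  qed
qed

lemma bdd_lipschitz_reflect:
  assumes "bdd_lipschitz f"
  shows "bdd_lipschitz (\<lambda>y. f (x - y))"
proof -
  obtain A L where f: "\<And>x. norm (f x) \<le> A" "\<And>x y. norm (f x - f y) \<le> L * norm (x - y)"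
    using assms by (auto simp: bdd_lipschitz_def)
  show ?thesis
  proof (rule bdd_lipschitzI)
    show "norm (f (x - y) - f (x - z)) \<le> L * norm (y - z)" for y z
      using f(2)[of "x - y" "x - z"] by (simp add: norm_minus_commute)
  qed (rule f)
qed

text \<open>The Cauchy kernel with its singularity removed: linear inside the ball of radius \<open>\<epsilon>\<close> and equal to
  \<^const>\<open>cauchy_kernel\<close> outside. Linearity inside makes its Fueter derivative constant there.\<close>

definition trunc_kernel :: "real \<Rightarrow> quat \<Rightarrow> quat"
  where "trunc_kernel \<epsilon> z = (1 / (2 * pi\<^sup>2)) *\<^sub>R (qcnj z /\<^sub>R max (norm z) \<epsilon> ^ 4)"

text \<open>The derivative of the truncated kernel off the sphere \<open>|z| = \<epsilon>\<close>, on which the kernel has a kink.\<close>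

definition trunc_kernel_deriv :: "real \<Rightarrow> quat \<Rightarrow> quat \<Rightarrow> quat"
  where "trunc_kernel_deriv \<epsilon> z h =
    (if norm z < \<epsilon> then (1 / (2 * pi\<^sup>2)) *\<^sub>R (qcnj h /\<^sub>R \<epsilon> ^ 4) else kernel_deriv z h)"

text \<open>With \<open>m(z) = max (|z|, \<epsilon>)\<close> the kernel is a multiple of the product of three factors \<open>1 / m\<close> and of
  \<open>cnj z / m\<close>. Each factor is bounded and Lipschitz; for the last one this uses \<open>|z| \<le> m(z)\<close>.\<close>

lemma bdd_lipschitz_trunc_kernel:
  assumes "\<epsilon> > 0"
  shows "bdd_lipschitz (trunc_kernel \<epsilon>)"
proof -
  define m where "m z = max (norm z) \<epsilon>" for z :: quat
  have m: "m z > 0" "inverse (m z) \<le> inverse \<epsilon>" "norm z \<le> m z" for z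
    using assms by (auto simp: m_def le_max_iff_disj max.strict_coboundedI2 intro!: le_imp_inverse_le)
  have m_lip: "\<bar>m z - m w\<bar> \<le> norm (z - w)" for z w
    using norm_triangle_ineq3[of z w] by (auto simp: m_def max_def abs_if split: if_splits)
  have r: "bdd_lipschitz (\<lambda>z. inverse (m z))"
  proof (rule bdd_lipschitzI)
    show "norm (inverse (m z)) \<le> inverse \<epsilon>" for z
      using m[of z] by simp
    show "norm (inverse (m z) - inverse (m w)) \<le> inverse \<epsilon> * inverse \<epsilon> * norm (z - w)" for z w
    proof -
      have "norm (inverse (m z) - inverse (m w)) = inverse (m z) * inverse (m w) * \<bar>m z - m w\<bar>"
        using m(1)[of z] m(1)[of w] 
        by (subst inverse_diff_inverse) (auto simp: abs_mult)
      also have "\<dots> \<le> inverse \<epsilon> * inverse \<epsilon> * norm (z - w)"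
        using m(1)[THEN less_imp_le] assms by (intro mult_mono m(2) m_lip) auto
      finally show ?thesis .
    qed
  qed
  have v: "bdd_lipschitz (\<lambda>z. inverse (m z) *\<^sub>R qcnj z)"
  proof (rule bdd_lipschitzI)
    show "norm (inverse (m z) *\<^sub>R qcnj z) \<le> 1" for z
      using m[of z] by (simp add: field_simps)
    show "norm (inverse (m z) *\<^sub>R qcnj z - inverse (m w) *\<^sub>R qcnj w) \<le> 2 * inverse \<epsilon> * norm (z - w)" for z w
    proof -
      have "inverse (m z) *\<^sub>R qcnj z - inverse (m w) *\<^sub>R qcnj w =
          inverse (m z) *\<^sub>R qcnj (z - w) + (inverse (m z) - inverse (m w)) *\<^sub>R qcnj w"
        by (simp add: linear_diff[OF bounded_linear.linear[OF bounded_linear_qcnj]] algebra_simps)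
      also have "norm \<dots> \<le> inverse (m z) * norm (z - w) + norm (inverse (m z) - inverse (m w)) * norm w"
        using m(1)[of z] by (intro norm_triangle_mono) simp_all
      also have "norm (inverse (m z) - inverse (m w)) * norm w \<le> inverse (m z) * norm (z - w)"
      proof -
        have "norm (inverse (m z) - inverse (m w)) * norm w
            = inverse (m z) * \<bar>m z - m w\<bar> * (inverse (m w) * norm w)"
          using m(1)[of z] m(1)[of w] 
          by (subst inverse_diff_inverse) (auto simp: abs_mult)
        also have "\<dots> \<le> inverse (m z) * norm (z - w) * 1"
          using m(1)[THEN less_imp_le] m(3)[of w] m(1)[of w]
          by (intro mult_mono m_lip) (auto simp: field_simps)
        finally show ?thesis by simp
      qed
      also have "inverse (m z) * norm (z - w) + inverse (m z) * norm (z - w) \<le> 2 * inverse \<epsilon> * norm (z - w)"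
        using mult_right_mono[OF m(2)[of z] norm_ge_zero[of "z - w"]] by simp
      finally show ?thesis by simp
    qed
  qed
  have "bdd_lipschitz (\<lambda>z. (1 / (2 * pi\<^sup>2)) *\<^sub>R
      (inverse (m z) *\<^sub>R (inverse (m z) *\<^sub>R (inverse (m z) *\<^sub>R (inverse (m z) *\<^sub>R qcnj z)))))"
    by (intro bdd_lipschitz_bilinear[OF bounded_bilinear_scaleR] r v bdd_lipschitz_const)
  then show ?thesis
    by (simp add: trunc_kernel_def[abs_def] m_def eval_nat_numeral mult.assoc)
qed

lemma has_derivative_trunc_kernel:
  assumes "\<epsilon> > 0" "norm z \<noteq> \<epsilon>"
  shows "(trunc_kernel \<epsilon> has_derivative trunc_kernel_deriv \<epsilon> z) (at z)"
proof (cases "norm z < \<epsilon>")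
  case True
  have "((\<lambda>z. (1 / (2 * pi\<^sup>2)) *\<^sub>R (qcnj z /\<^sub>R \<epsilon> ^ 4)) has_derivative trunc_kernel_deriv \<epsilon> z) (at z)"
    unfolding trunc_kernel_deriv_def[abs_def] if_P[OF True]
    by (intro has_derivative_scaleR_right bounded_linear_imp_has_derivative bounded_linear_qcnj)
  then show ?thesis
    by (rule has_derivative_transform_within_open[where s = "ball 0 \<epsilon>"])
      (use True in \<open>auto simp: trunc_kernel_def max_def\<close>)
next
  case False
  with assms have z: "\<epsilon> < norm z" by simp
  have "(cauchy_kernel has_derivative trunc_kernel_deriv \<epsilon> z) (at z)"
    unfolding trunc_kernel_deriv_def[abs_def] if_not_P[OF False]
    using z assms(1) by (intro has_derivative_cauchy_kernel) auto
  then show ?thesis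
    by (rule has_derivative_transform_within_open[where s = "- cball 0 \<epsilon>"])
      (use z in \<open>auto simp: trunc_kernel_def cauchy_kernel_def max_def\<close>)
qed

text \<open>The ball of radius \<open>\<epsilon>\<close> in \<open>\<real>\<^sup>4\<close> has volume \<open>\<pi>\<^sup>2 \<epsilon>\<^sup>4 / 2\<close>. The constant is thus the inverse of the volume,
  and this is where the normalization of the Cauchy kernel enters.\<close>

lemma right_fueter_trunc_kernel:
  assumes "\<epsilon> > 0"
  shows "trunc_kernel_deriv \<epsilon> z 1 + trunc_kernel_deriv \<epsilon> z qe1 * qe1
    + trunc_kernel_deriv \<epsilon> z qe2 * qe2 + trunc_kernel_deriv \<epsilon> z qe3 * qe3
    = (if norm z < \<epsilon> then of_real (2 / (pi\<^sup>2 * \<epsilon> ^ 4)) else 0)"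
proof (cases "norm z < \<epsilon>")
  case True
  have "qcnj 1 + qcnj qe1 * qe1 + qcnj qe2 * qe2 + qcnj qe3 * qe3 = 4"
    by (simp add: quat_eq_iff)
  moreover have "trunc_kernel_deriv \<epsilon> z 1 + trunc_kernel_deriv \<epsilon> z qe1 * qe1
    + trunc_kernel_deriv \<epsilon> z qe2 * qe2 + trunc_kernel_deriv \<epsilon> z qe3 * qe3 =
    (1 / (2 * pi\<^sup>2)) *\<^sub>R ((qcnj 1 + qcnj qe1 * qe1 + qcnj qe2 * qe2 + qcnj qe3 * qe3) /\<^sub>R \<epsilon> ^ 4)"
    using True by (simp add: trunc_kernel_deriv_def scaleR_add_right)
  moreover have "(1 / (2 * pi\<^sup>2)) *\<^sub>R ((4::quat) /\<^sub>R \<epsilon> ^ 4) = of_real (2 / (pi\<^sup>2 * \<epsilon> ^ 4))"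
  proof -
    have "(4::quat) = 4 *\<^sub>R 1"
      by (simp add: scaleR_conv_of_real)
    moreover have "1 / (2 * pi\<^sup>2) * (inverse (\<epsilon> ^ 4) * 4) = 2 / (pi\<^sup>2 * \<epsilon> ^ 4)"
      using assms by (simp add: field_simps)
    ultimately show ?thesis
      unfolding of_real_def by (metis scaleR_scaleR)
  qed
  ultimately show ?thesis
    using True by simp
next
  case False
  then have "z \<noteq> 0" using assms by auto
  then show ?thesis
    using False right_fueter_kernel_deriv[of z] by (simp add: trunc_kernel_deriv_def)
qed

lemma norm_trunc_kernel_le: "norm (trunc_kernel \<epsilon> z) \<le> norm (cauchy_kernel z)"
proof (cases "z = 0")
  case True
  then show ?thesis by (simp add: trunc_kernel_def)
next
  case False
  then have pos: "max (norm z) \<epsilon> > 0"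
    by (simp add: max.strict_coboundedI1)
  have "norm z / max (norm z) \<epsilon> ^ 4 \<le> norm z / norm z ^ 4"
    using False pos by (intro divide_left_mono power_mono mult_pos_pos zero_less_power) simp_all
  then have "norm (qcnj z /\<^sub>R max (norm z) \<epsilon> ^ 4) \<le> norm (qcnj z /\<^sub>R norm z ^ 4)"
    using pos by (simp add: divide_inverse mult.commute)
  then show ?thesis
    unfolding trunc_kernel_def cauchy_kernel_def norm_scaleR[of "1 / (2 * pi\<^sup>2)"]
    by (intro mult_left_mono) simp_all
qed

lemma trunc_kernel_tendsto: "(\<lambda>n. trunc_kernel (inverse (real (Suc n))) z) \<longlonglongrightarrow> cauchy_kernel z"
proof (cases "z = 0")
  case True
  then show ?thesis by (simp add: trunc_kernel_def cauchy_kernel_def qcnj_def zero_quat_def[symmetric])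
next
  case False
  have "\<forall>\<^sub>F n in sequentially. inverse (real (Suc n)) < norm z"
    using LIMSEQ_inverse_real_of_nat False by (intro order_tendstoD) auto
  then have "\<forall>\<^sub>F n in sequentially. trunc_kernel (inverse (real (Suc n))) z = cauchy_kernel z"
    by eventually_elim (simp add: trunc_kernel_def cauchy_kernel_def max_def)
  then show ?thesis
    by (rule tendsto_eventually)
qed

section \<open>The Cauchy--Pompeiu formula for compactly supported functions\<close>

lemma C1_on_compact_support_bounds:
  fixes u :: "quat \<Rightarrow> quat"
  assumes f': "\<And>y. (u has_derivative blinfun_apply (f' y)) (at y)" "continuous_on UNIV f'"
    and supp: "\<And>y. norm y \<ge> R \<Longrightarrow> u y = 0"
  shows "bdd_lipschitz u" "f' y = 0 \<or> norm y \<le> R"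
proof -
  have zero: "f' y = 0" if "norm y > R" for y
  proof -
    have "(u has_derivative (\<lambda>_. 0)) (at y)"
      by (rule has_derivative_transform_within_open[where f="\<lambda>_. 0" and s="- cball 0 R"])
        (use that supp in auto)
    with f'(1)[of y] have "blinfun_apply (f' y) = (\<lambda>_. 0)"
      by (rule has_derivative_unique)
    then show ?thesis
      by (simp add: blinfun_eqI)
  qed
  then show "f' y = 0 \<or> norm y \<le> R"
    by force
  have "bounded (f' ` cball 0 R)"
    by (intro compact_imp_bounded compact_continuous_image continuous_on_subset[OF f'(2)]) auto
  then obtain B where B: "\<And>y. y \<in> cball 0 R \<Longrightarrow> norm (f' y) \<le> B"
    unfolding bounded_iff by blast
  have B': "norm (f' y) \<le> max B 0" for y
    using B[of y] zero[of y] by (cases "norm y \<le> R") auto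
  have cont: "continuous_on UNIV u"
    using f'(1) by (auto intro!: continuous_at_imp_continuous_on intro: has_derivative_continuous)
  have "bounded (u ` cball 0 R)"
    by (intro compact_imp_bounded compact_continuous_image continuous_on_subset[OF cont]) auto
  then obtain A where A: "\<And>y. y \<in> cball 0 R \<Longrightarrow> norm (u y) \<le> A"
    unfolding bounded_iff by blast
  show "bdd_lipschitz u"
  proof (rule bdd_lipschitzI)
    show "norm (u y) \<le> max A 0" for y
      using A[of y] supp[of y] by (cases "norm y \<le> R") auto
    show "norm (u y - u z) \<le> max B 0 * norm (y - z)" for y z
      using f'(1) B'
      by (intro differentiable_bound[of UNIV u "\<lambda>y. blinfun_apply (f' y)"])
        (auto simp: norm_blinfun.rep_eq[symmetric])
  qed
qed

lemma ball_average:
  assumes lip: "\<And>y z. norm (u y - u z) \<le> L * norm (y - z :: quat)" and [measurable]: "u \<in> borel_measurable borel"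
    and bdd: "\<And>y. norm (u y :: quat) \<le> A" and "\<epsilon> > 0"
  defines "c \<equiv> 2 / (pi\<^sup>2 * \<epsilon> ^ 4)"
  shows "integrable lborel (\<lambda>y. (c * indicator (ball x \<epsilon>) y) *\<^sub>R u y)"
    and "norm ((LINT y|lborel. (c * indicator (ball x \<epsilon>) y) *\<^sub>R u y) - u x) \<le> L * \<epsilon>"
proof -
  have c: "c > 0"
    using \<open>\<epsilon> > 0\<close> by (simp add: c_def)
  have [measurable]: "ball x \<epsilon> \<in> sets borel"
    by simp
  have i: "integrable lborel (\<lambda>y. c * indicator (ball x \<epsilon>) y)"
    by (intro integrable_mult_right integrable_real_indicator emeasure_lborel_ball_finite) simp
  have vol: "(LINT y|lborel. c * indicator (ball x \<epsilon>) y) = 1"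
    using \<open>\<epsilon> > 0\<close> by (simp add: content_ball DIM_quat unit_ball_vol_4 c_def)
  show int: "integrable lborel (\<lambda>y. (c * indicator (ball x \<epsilon>) y) *\<^sub>R u y)"
  proof (rule Bochner_Integration.integrable_bound)
    show "integrable lborel (\<lambda>y. (c * indicator (ball x \<epsilon>) y) * A)"
      using i by (rule integrable_mult_left)
    show "AE y in lborel. norm ((c * indicator (ball x \<epsilon>) y) *\<^sub>R u y) \<le> norm (c * indicator (ball x \<epsilon>) y * A)"
    proof (rule AE_I2)
      fix y
      show "norm ((c * indicator (ball x \<epsilon>) y) *\<^sub>R u y) \<le> norm (c * indicator (ball x \<epsilon>) y * A)"
        using order_trans[OF bdd abs_ge_self] by (auto simp: abs_mult intro!: mult_left_mono)
    qed
  qed measurable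
  have int': "integrable lborel (\<lambda>y. (c * indicator (ball x \<epsilon>) y) *\<^sub>R u x)"
    using i by (rule integrable_scaleR_left)
  have "(LINT y|lborel. (c * indicator (ball x \<epsilon>) y) *\<^sub>R u y) - u x =
      (LINT y|lborel. (c * indicator (ball x \<epsilon>) y) *\<^sub>R u y) - (LINT y|lborel. (c * indicator (ball x \<epsilon>) y) *\<^sub>R u x)"
    using i by (subst integral_scaleR_left) (simp_all only: vol scaleR_one)
  also have "\<dots> = (LINT y|lborel. (c * indicator (ball x \<epsilon>) y) *\<^sub>R u y - (c * indicator (ball x \<epsilon>) y) *\<^sub>R u x)"
    using int int' by (rule Bochner_Integration.integral_diff[symmetric])
  also have "norm \<dots> \<le> (LINT y|lborel. (c * indicator (ball x \<epsilon>) y) * (L * \<epsilon>))"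
  proof (rule order_trans[OF integral_norm_bound integral_mono])
    show "integrable lborel (\<lambda>y. norm ((c * indicator (ball x \<epsilon>) y) *\<^sub>R u y - (c * indicator (ball x \<epsilon>) y) *\<^sub>R u x))"
      using int int' by (intro integrable_norm Bochner_Integration.integrable_diff)
    show "integrable lborel (\<lambda>y. (c * indicator (ball x \<epsilon>) y) * (L * \<epsilon>))"
      using i by (rule integrable_mult_left)
    have "L \<ge> 0"
      using order_trans[OF norm_ge_zero lip[of 1 0]] by simp
    show "norm ((c * indicator (ball x \<epsilon>) y) *\<^sub>R u y - (c * indicator (ball x \<epsilon>) y) *\<^sub>R u x) 
      \<le> (c * indicator (ball x \<epsilon>) y) * (L * \<epsilon>)" for y
    proof (cases "y \<in> ball x \<epsilon>")
      case True
      then have "norm (u y - u x) \<le> L * \<epsilon>"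
        using \<open>L \<ge> 0\<close> by (intro order_trans[OF lip] mult_left_mono) (auto simp: dist_norm norm_minus_commute)
      then show ?thesis
        using True c by (simp flip: scaleR_diff_right)
    qed simp
  qed
  also have "\<dots> = L * \<epsilon>"
    by (simp only: integral_mult_left_zero vol mult_1)
  finally show "norm ((LINT y|lborel. (c * indicator (ball x \<epsilon>) y) *\<^sub>R u y) - u x) \<le> L * \<epsilon>" .
qed

text \<open>For the truncated kernel, \<open>integral_directional_derivative_eq_0\<close> is applied to
  \<open>y \<mapsto> K\<^sub>\<epsilon>(x - y) e u(y)\<close> in the directions \<open>e = 1, e\<^sub>1, e\<^sub>2, e\<^sub>3\<close>. In the sum of the four identities the
  derivatives of \<open>u\<close> assemble to \<open>D u\<close>, those of \<open>K\<^sub>\<epsilon>\<close> to its right Fueter derivative. Since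
  \<open>|K\<^sub>\<epsilon>| \<le> |K|\<close>, dominated convergence gives the limit.\<close>

theorem cauchy_pompeiu_compact_support:
  assumes "u \<in> C1_on UNIV" and supp: "\<And>y. norm y \<ge> R \<Longrightarrow> u y = 0"
  shows "has_bochner_integral lborel (\<lambda>y. cauchy_kernel (x - y) * fueter u y) (u x)"
proof -
  obtain f' :: "quat \<Rightarrow> quat \<Rightarrow>\<^sub>L quat"
    where f': "\<And>y. (u has_derivative f' y) (at y)" "continuous_on UNIV f'"
    using assms by (auto simp: C1_on_def)
  have bounds: "bdd_lipschitz u" "\<And>y. f' y = 0 \<or> norm y \<le> R"
    using C1_on_compact_support_bounds[of u f' R] f' supp by blast+
  obtain A L where A: "\<And>x. norm (u x) \<le> A" and L: "\<And>x y. norm (u x - u y) \<le> L * norm (x - y)"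
    using bounds(1) by (auto simp: bdd_lipschitz_def)
  have fu: "fueter u y = f' y 1 + qe1 * f' y qe1 + qe2 * f' y qe2 + qe3 * f' y qe3" for y
    using fueter_eq_symbol[OF f'(1)[of y]] by (simp add: fueter_symbol_def)
  have [measurable]: "u \<in> borel_measurable borel"
    using assms(1) by (intro borel_measurable_continuous_onI C1_on_imp_continuous_on)
  have [measurable]: "(\<lambda>y. f' y h) \<in> borel_measurable borel" for h
    by (intro borel_measurable_continuous_onI continuous_intros f')
  have [measurable]: "fueter u \<in> borel_measurable borel"
    using assms(1) by (intro borel_measurable_continuous_onI continuous_on_fueter)

  have trunc: "has_bochner_integral lborel (\<lambda>y. trunc_kernel \<epsilon> (x - y) * fueter u y)
      (LINT y|lborel. (2 / (pi\<^sup>2 * \<epsilon> ^ 4) * indicator (ball x \<epsilon>) y) *\<^sub>R u y)"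
    if "\<epsilon> > 0" for \<epsilon>
  proof -
    have cont: "continuous_on UNIV (trunc_kernel \<epsilon>)"
      unfolding trunc_kernel_def using that
      by (intro continuous_intros linear_continuous_on bounded_linear_qcnj) auto
    have [measurable]: "trunc_kernel \<epsilon> \<in> borel_measurable borel"
      using cont by (rule borel_measurable_continuous_onI)
    have [measurable]: "(\<lambda>z. trunc_kernel_deriv \<epsilon> z h) \<in> borel_measurable borel" for h
      unfolding trunc_kernel_deriv_def by measurable
    have part: "has_bochner_integral lborel
       (\<lambda>y. trunc_kernel \<epsilon> (x - y) * e * f' y e - trunc_kernel_deriv \<epsilon> (x - y) e * e * u y) 0" for e
    proof -
      have "bdd_lipschitz (\<lambda>y. trunc_kernel \<epsilon> (x - y) * e * u y)"
        by (intro bdd_lipschitz_bilinear[OF bounded_bilinear_mult] bdd_lipschitz_const bounds(1)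
          bdd_lipschitz_reflect bdd_lipschitz_trunc_kernel that)
      then obtain M where M: "\<And>y z. norm (trunc_kernel \<epsilon> (x - y) * e * u y - trunc_kernel \<epsilon> (x - z) * e * u z)
         \<le> M * norm (y - z)"
        by (auto simp: bdd_lipschitz_def)
      show ?thesis
      proof (rule integral_directional_derivative_eq_0[where e=e, OF M])
        show "trunc_kernel \<epsilon> (x - y) * e * u y = 0" if "norm y \<ge> R" for y
          using supp[OF that] by simp
        have "negligible (sphere x \<epsilon>)"
          by (rule negligible_sphere)
        then have "sphere x \<epsilon> \<in> null_sets lborel"
          by (simp add: negligible_iff_null_sets null_sets_completion_iff)
        then have "AE y in lborel. y \<notin> sphere x \<epsilon>"
          by (rule AE_not_in)
        then show "AE y in lborel. ((\<lambda>t. trunc_kernel \<epsilon> (x - (y + t *\<^sub>R e)) * e * u (y + t *\<^sub>R e)) has_vector_derivative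
             trunc_kernel \<epsilon> (x - y) * e * f' y e - trunc_kernel_deriv \<epsilon> (x - y) e * e * u y) (at 0)"
        proof eventually_elim
          fix y assume "y \<notin> sphere x \<epsilon>"
          then have K: "(trunc_kernel \<epsilon> has_derivative trunc_kernel_deriv \<epsilon> (x - y)) (at (x - y))"
            using that by (intro has_derivative_trunc_kernel) (auto simp: dist_norm)
          have "((\<lambda>t. x - (y + t *\<^sub>R e)) has_derivative (\<lambda>t. - (t *\<^sub>R e))) (at 0)"
            by (auto intro!: derivative_eq_intros)
          then have K': "((\<lambda>t. trunc_kernel \<epsilon> (x - (y + t *\<^sub>R e))) has_derivative
              (\<lambda>t. trunc_kernel_deriv \<epsilon> (x - y) (- (t *\<^sub>R e)))) (at 0)"
            by (rule has_derivative_compose) (use K in simp)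
          have "((\<lambda>t. y + t *\<^sub>R e) has_derivative (\<lambda>t. t *\<^sub>R e)) (at 0)"
            by (auto intro!: derivative_eq_intros)
          then have u': "((\<lambda>t. u (y + t *\<^sub>R e)) has_derivative (\<lambda>t. f' y (t *\<^sub>R e))) (at 0)"
            by (rule has_derivative_compose) (use f'(1) in simp)
          have lin: "trunc_kernel_deriv \<epsilon> (x - y) (- (t *\<^sub>R e)) = - t *\<^sub>R trunc_kernel_deriv \<epsilon> (x - y) e" for t
            using has_derivative_linear[OF K] by (simp add: linear_neg linear_scale)
          show "((\<lambda>t. trunc_kernel \<epsilon> (x - (y + t *\<^sub>R e)) * e * u (y + t *\<^sub>R e)) has_vector_derivative
             trunc_kernel \<epsilon> (x - y) * e * f' y e - trunc_kernel_deriv \<epsilon> (x - y) e * e * u y) (at 0)"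
            using has_derivative_mult[OF has_derivative_mult[OF K' has_derivative_const[of e]] u']
            unfolding has_vector_derivative_def
            by (rule has_derivative_eq_rhs) (simp add: lin blinfun.scaleR_right fun_eq_iff algebra_simps)
        qed
        show "(\<lambda>y. trunc_kernel \<epsilon> (x - y) * e * f' y e - trunc_kernel_deriv \<epsilon> (x - y) e * e * u y)
          \<in> borel_measurable borel"
          by measurable
      qed
    qed
    have "has_bochner_integral lborel (\<lambda>y. trunc_kernel \<epsilon> (x - y) * fueter u y
        - (2 / (pi\<^sup>2 * \<epsilon> ^ 4) * indicator (ball x \<epsilon>) y) *\<^sub>R u y) 0"
    proof -
      have "trunc_kernel \<epsilon> (x - y) * fueter u y - (2 / (pi\<^sup>2 * \<epsilon> ^ 4) * indicator (ball x \<epsilon>) y) *\<^sub>R u y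
        = (trunc_kernel \<epsilon> (x - y) * 1 * f' y 1 - trunc_kernel_deriv \<epsilon> (x - y) 1 * 1 * u y)
        + (trunc_kernel \<epsilon> (x - y) * qe1 * f' y qe1 - trunc_kernel_deriv \<epsilon> (x - y) qe1 * qe1 * u y)
        + (trunc_kernel \<epsilon> (x - y) * qe2 * f' y qe2 - trunc_kernel_deriv \<epsilon> (x - y) qe2 * qe2 * u y)
        + (trunc_kernel \<epsilon> (x - y) * qe3 * f' y qe3 - trunc_kernel_deriv \<epsilon> (x - y) qe3 * qe3 * u y)"
        (is "?l = ?r") for y
      proof -
        have "(2 / (pi\<^sup>2 * \<epsilon> ^ 4) * indicator (ball x \<epsilon>) y) *\<^sub>R u y =
          (if norm (x - y) < \<epsilon> then of_real (2 / (pi\<^sup>2 * \<epsilon> ^ 4)) else 0) * u y"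
          by (auto simp: dist_norm scaleR_conv_of_real indicator_def simp del: of_real_divide)
        then show ?thesis
          unfolding right_fueter_trunc_kernel[OF that, symmetric] fu
          by (simp add: algebra_simps)
      qed
      then show ?thesis
        using has_bochner_integral_add[OF has_bochner_integral_add[OF has_bochner_integral_add[OF
          part[of 1] part[of qe1]] part[of qe2]] part[of qe3]] by simp
    qed
    from has_bochner_integral_add[OF this has_bochner_integral_integrable[OF ball_average(1)[OF L _ A that, of x]]]
    show ?thesis by simp
  qed

  have int: "integrable lborel (\<lambda>y. cauchy_kernel (x - y) * fueter u y)"
  proof -
    have "bounded (fueter u ` cball 0 R)"
      by (intro compact_imp_bounded compact_continuous_image continuous_on_subset[OF continuous_on_fueter[OF assms(1)]]) auto
    then obtain B where B: "\<And>y. y \<in> cball 0 R \<Longrightarrow> norm (fueter u y) \<le> B"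
      unfolding bounded_iff by blast
    have zero: "fueter u y = 0" if "norm y > R" for y
      using bounds(2)[of y] that by (auto simp: fu)
    show ?thesis
    proof (rule integrable_kernel_times[where B="max B 0" and R="norm x + \<bar>R\<bar> + 1"])
      show "norm (fueter u y) \<le> max B 0" for y
        using B[of y] zero[of y] by (cases "norm y \<le> R") auto
      show "fueter u y = 0" if "y \<notin> ball x (norm x + \<bar>R\<bar> + 1)" for y
        using that norm_triangle_ineq4[of x y] by (intro zero) (auto simp: dist_norm)
    qed simp
  qed
  define \<epsilon> where "\<epsilon> n = inverse (real (Suc n))" for n
  have \<epsilon>: "\<epsilon> n > 0" for n
    by (simp add: \<epsilon>_def)
  have "(\<lambda>n. LINT y|lborel. trunc_kernel (\<epsilon> n) (x - y) * fueter u y)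
      \<longlonglongrightarrow> (LINT y|lborel. cauchy_kernel (x - y) * fueter u y)"
  proof (rule integral_dominated_convergence)
    show "integrable lborel (\<lambda>y. norm (cauchy_kernel (x - y) * fueter u y))"
      using int by (rule integrable_norm)
    show "AE y in lborel. (\<lambda>n. trunc_kernel (\<epsilon> n) (x - y) * fueter u y) \<longlonglongrightarrow> cauchy_kernel (x - y) * fueter u y"
      unfolding \<epsilon>_def by (intro AE_I2 tendsto_mult trunc_kernel_tendsto tendsto_const)
    show "AE y in lborel. norm (trunc_kernel (\<epsilon> n) (x - y) * fueter u y) \<le> norm (cauchy_kernel (x - y) * fueter u y)" for n
      by (intro AE_I2) (simp add: norm_mult mult_right_mono norm_trunc_kernel_le)
    show "(\<lambda>y. trunc_kernel (\<epsilon> n) (x - y) * fueter u y) \<in> borel_measurable lborel" for n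
      using trunc[OF \<epsilon>[of n]] by (auto dest: borel_measurable_has_bochner_integral)
  qed measurable
  moreover have "(\<lambda>n. LINT y|lborel. trunc_kernel (\<epsilon> n) (x - y) * fueter u y) \<longlonglongrightarrow> u x"
  proof (rule LIM_zero_cancel, rule Lim_null_comparison)
    show "\<forall>\<^sub>F n in sequentially. norm ((LINT y|lborel. trunc_kernel (\<epsilon> n) (x - y) * fueter u y) - u x) \<le> L * \<epsilon> n"
    proof (intro always_eventually allI)
      fix n
      show "norm ((LINT y|lborel. trunc_kernel (\<epsilon> n) (x - y) * fueter u y) - u x) \<le> L * \<epsilon> n"
        using ball_average(2)[OF L _ A \<epsilon>[of n], where x=x]
          has_bochner_integral_integral_eq[OF trunc[OF \<epsilon>[of n]]]
        by simp
    qed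
    show "(\<lambda>n. L * \<epsilon> n) \<longlonglongrightarrow> 0"
      unfolding \<epsilon>_def using tendsto_mult_right_zero[OF LIMSEQ_inverse_real_of_nat] .
  qed
  ultimately have "(LINT y|lborel. cauchy_kernel (x - y) * fueter u y) = u x"
    by (rule LIMSEQ_unique)
  with int show ?thesis
    by (simp add: has_bochner_integral_iff)
qed

section \<open>Potentials of densities away from the point\<close>

text \<open>Near a point \<open>x\<close> of the ball the differences \<open>x' - y\<close>, with \<open>y\<close> in the support of \<open>w\<close>, stay in a compact
  shell that avoids \<open>0\<close>. There the derivative of the kernel is bounded and uniformly continuous, which
  makes the linearization error of the kernel uniformly small in \<open>y\<close>. Therefore differentiation under the
  integral sign needs only integrability of \<open>w\<close>.\<close>

theorem kernel_potential_hyperholomorphic: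
  fixes w G :: "quat \<Rightarrow> quat"
  assumes w: "integrable lborel w"
    and inner: "\<And>y. norm y < r \<Longrightarrow> w y = 0" and outer: "\<And>y. norm y \<ge> R \<Longrightarrow> w y = 0"
    and G: "\<And>x. x \<in> ball 0 r \<Longrightarrow> G x = (LINT y|lborel. cauchy_kernel (x - y) * w y)"
  shows "G \<in> hyperholomorphic (ball 0 r)"
proof -
  have [measurable]: "w \<in> borel_measurable lborel"
    using w by (rule borel_measurable_integrable)
  obtain K' :: "quat \<Rightarrow> quat \<Rightarrow>\<^sub>L quat"
    where K': "\<And>z. z \<noteq> 0 \<Longrightarrow> (cauchy_kernel has_derivative K' z) (at z)" "continuous_on (- {0}) K'"
    using C1_on_cauchy_kernel by (auto simp: C1_on_def)
  have K'_eq: "K' z h = kernel_deriv z h" if "z \<noteq> 0" for z h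
    using has_derivative_unique[OF K'(1)[OF that] has_derivative_cauchy_kernel[OF that]] by simp
  define W where "W = (LINT y|lborel. norm (w y))"
  have W: "W \<ge> 0"
    by (simp add: W_def)
  define D where "D x h = (LINT y|lborel. kernel_deriv (x - y) h * w y)" for x h

  have bound_mult: "integrable lborel (\<lambda>y. k y * w y)"
      "norm (LINT y|lborel. k y * w y) \<le> B * W"
    if [measurable]: "k \<in> borel_measurable borel"
      and B: "\<And>y. r \<le> norm y \<Longrightarrow> norm y < R \<Longrightarrow> norm (k y) \<le> B" for k :: "quat \<Rightarrow> quat" and B
  proof -
    have le: "norm (k y * w y) \<le> B * norm (w y)" for y
      using B[of y] inner[of y] outer[of y]
      by (cases "r \<le> norm y \<and> norm y < R") (auto simp: norm_mult not_le not_less intro: mult_right_mono)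
    have i: "integrable lborel (\<lambda>y. B * norm (w y))"
      using w by simp
    show int: "integrable lborel (\<lambda>y. k y * w y)"
      by (rule Bochner_Integration.integrable_bound[OF i])
         (use order_trans[OF le abs_ge_self] in \<open>auto\<close>)
    have "norm (LINT y|lborel. k y * w y) \<le> (LINT y|lborel. B * norm (w y))"
      by (rule order_trans[OF integral_norm_bound integral_mono]) (use int i le in auto)
    then show "norm (LINT y|lborel. k y * w y) \<le> B * W"
      by (simp add: W_def)
  qed

  \<comment> \<open>The uniform bounds and the uniform modulus of continuity near \<open>x\<close>; the radius \<open>\<rho>\<close> lies strictly
    between \<open>|x|\<close> and \<open>r\<close>, which keeps \<open>x' - y\<close> at distance at least \<open>r - \<rho>\<close> from \<open>0\<close>.\<close>
  have local: "\<exists>\<rho>. norm x < \<rho> \<and> \<rho> < r \<and> (\<exists>B. \<forall>y. r \<le> norm y \<longrightarrow> norm y < R \<longrightarrow> 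
        (\<forall>x'\<in>ball 0 \<rho>. norm (cauchy_kernel (x' - y)) \<le> B \<and> norm (K' (x' - y)) \<le> B)) \<and>
     (\<forall>e>0. \<exists>d>0. \<forall>x'\<in>ball 0 \<rho>. dist x' x < d \<longrightarrow>
       (\<forall>y. r \<le> norm y \<longrightarrow> norm y < R \<longrightarrow> norm (K' (x' - y) - K' (x - y)) \<le> e))"
    if x: "x \<in> ball 0 r" for x
  proof -
    define \<rho> where "\<rho> = (norm x + r) / 2"
    have \<rho>: "norm x < \<rho>" "\<rho> < r"
      using x by (auto simp: \<rho>_def)
    define S where "S = cball (0::quat) (\<rho> + \<bar>R\<bar>) - ball 0 (r - \<rho>)"
    have "compact S"
      unfolding S_def by (intro compact_diff) auto
    have S0: "S \<subseteq> - {0}"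
      using \<rho> by (auto simp: S_def)
    have inS: "x' - y \<in> S" if "x' \<in> ball 0 \<rho>" "r \<le> norm y" "norm y < R" for x' y
      using that norm_triangle_ineq4[of x' y] norm_triangle_ineq2[of y x']
      by (auto simp: S_def norm_minus_commute)
    have "compact (K' ` S)" "compact (cauchy_kernel ` S)"
      using \<open>compact S\<close> S0 K'(2) C1_on_imp_continuous_on[OF C1_on_cauchy_kernel]
      by (auto intro!: compact_continuous_image intro: continuous_on_subset)
    then have "bounded (K' ` S)" "bounded (cauchy_kernel ` S)"
      by (auto intro: compact_imp_bounded)
    then obtain B1 B2 where B: "\<And>z. z \<in> S \<Longrightarrow> norm (K' z) \<le> B1" "\<And>z. z \<in> S \<Longrightarrow> norm (cauchy_kernel z) \<le> B2"
      unfolding bounded_iff by blast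
    have uc: "uniformly_continuous_on S K'"
      using \<open>compact S\<close> S0 by (intro compact_uniformly_continuous continuous_on_subset[OF K'(2)])
    show ?thesis
    proof (rule exI[of _ \<rho>], intro conjI)
      show "\<exists>B. \<forall>y. r \<le> norm y \<longrightarrow> norm y < R \<longrightarrow> 
        (\<forall>x'\<in>ball 0 \<rho>. norm (cauchy_kernel (x' - y)) \<le> B \<and> norm (K' (x' - y)) \<le> B)"
        using B inS by (intro exI[of _ "max B1 B2"]) (auto simp: le_max_iff_disj)
      show "\<forall>e>0. \<exists>d>0. \<forall>x'\<in>ball 0 \<rho>. dist x' x < d \<longrightarrow>
         (\<forall>y. r \<le> norm y \<longrightarrow> norm y < R \<longrightarrow> norm (K' (x' - y) - K' (x - y)) \<le> e)"
      proof (intro allI impI)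
        fix e :: real assume "e > 0"
        then obtain d where d: "d > 0" "\<And>z z'. z \<in> S \<Longrightarrow> z' \<in> S \<Longrightarrow> dist z' z < d \<Longrightarrow> dist (K' z') (K' z) < e"
          using uc unfolding uniformly_continuous_on_def by metis
        show "\<exists>d>0. \<forall>x'\<in>ball 0 \<rho>. dist x' x < d \<longrightarrow>
         (\<forall>y. r \<le> norm y \<longrightarrow> norm y < R \<longrightarrow> norm (K' (x' - y) - K' (x - y)) \<le> e)"
        proof (intro exI conjI ballI impI allI)
          fix x' y :: quat assume "x' \<in> ball 0 \<rho>" "dist x' x < d" "r \<le> norm y" "norm y < R"
          then have "dist (K' (x' - y)) (K' (x - y)) < e"
            using \<rho> by (intro d inS) (auto simp: dist_norm)
          then show "norm (K' (x' - y) - K' (x - y)) \<le> e"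
            by (simp add: dist_norm)
        qed (rule d)
      qed
    qed (use \<rho> in auto)
  qed

  have nonzero: "x - y \<noteq> 0" if "x \<in> ball 0 r" "r \<le> norm y" for x y :: quat
    using that by auto

  have intD: "integrable lborel (\<lambda>y. kernel_deriv (x - y) h * w y)" if x: "x \<in> ball 0 r" for x h
  proof -
    obtain \<rho> B where \<rho>: "norm x < \<rho>"
      and B: "\<And>y. r \<le> norm y \<Longrightarrow> norm y < R \<Longrightarrow> \<forall>x'\<in>ball 0 \<rho>. norm (cauchy_kernel (x' - y)) \<le> B \<and> norm (K' (x' - y)) \<le> B"
      using local[OF x] by blast
    show ?thesis
    proof (rule bound_mult(1))
      show "norm (kernel_deriv (x - y) h) \<le> B * norm h" if y: "r \<le> norm y" "norm y < R" for y
      proof -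
        have "norm (K' (x - y)) \<le> B"
          using B[OF y] \<rho> by auto
        from order_trans[OF norm_blinfun mult_right_mono[OF this norm_ge_zero]] show ?thesis
          by (simp add: K'_eq[OF nonzero[OF x y(1)]])
      qed
    qed measurable
  qed
  have intK: "integrable lborel (\<lambda>y. cauchy_kernel (x - y) * w y)" if x: "x \<in> ball 0 r" for x
  proof -
    obtain \<rho> B where \<rho>: "norm x < \<rho>"
      and B: "\<And>y. r \<le> norm y \<Longrightarrow> norm y < R \<Longrightarrow> \<forall>x'\<in>ball 0 \<rho>. norm (cauchy_kernel (x' - y)) \<le> B \<and> norm (K' (x' - y)) \<le> B"
      using local[OF x] by blast
    show ?thesis
      by (rule bound_mult(1)[of _ B]) (use B \<rho> in auto)
  qed

  have D: "(G has_derivative D x) (at x)" if x: "x \<in> ball 0 r" for x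
    unfolding has_derivative_at_alt
  proof (intro conjI allI impI)
    obtain \<rho> B where \<rho>: "norm x < \<rho>" "\<rho> < r"
      and B: "\<And>y. r \<le> norm y \<Longrightarrow> norm y < R \<Longrightarrow> \<forall>x'\<in>ball 0 \<rho>. norm (cauchy_kernel (x' - y)) \<le> B \<and> norm (K' (x' - y)) \<le> B"
      and uc: "\<And>e. e > 0 \<Longrightarrow> \<exists>d>0. \<forall>x'\<in>ball 0 \<rho>. dist x' x < d \<longrightarrow>
       (\<forall>y. r \<le> norm y \<longrightarrow> norm y < R \<longrightarrow> norm (K' (x' - y) - K' (x - y)) \<le> e)"
      using local[OF x] by blast
    have kd_add: "kernel_deriv z (h + k) = kernel_deriv z h + kernel_deriv z k"
      and kd_scale: "kernel_deriv z (c *\<^sub>R h) = c *\<^sub>R kernel_deriv z h" for z h k c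
      by (simp_all add: kernel_deriv_def quat_eq_iff inner_add_right algebra_simps add_divide_distrib diff_divide_distrib)
    show "bounded_linear (D x)"
    proof (rule bounded_linear_intro)
      show "D x (h + k) = D x h + D x k" for h k
        unfolding D_def kd_add distrib_right using intD[OF x] by (rule Bochner_Integration.integral_add) (rule intD[OF x])
      show "D x (c *\<^sub>R h) = c *\<^sub>R D x h" for c h
        unfolding D_def kd_scale mult_scaleR_left by (rule integral_scaleR_right)
      show "norm (D x h) \<le> norm h * (B * W)" for h
      proof -
        have "norm (D x h) \<le> (B * norm h) * W"
          unfolding D_def
        proof (rule bound_mult(2))
          show "norm (kernel_deriv (x - y) h) \<le> B * norm h" if y: "r \<le> norm y" "norm y < R" for y
          proof -
            have "norm (K' (x - y)) \<le> B"
              using B[OF y] \<rho> by auto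
            from order_trans[OF norm_blinfun mult_right_mono[OF this norm_ge_zero]] show ?thesis
              by (simp add: K'_eq[OF nonzero[OF x y(1)]])
          qed
        qed measurable
        then show ?thesis by (simp add: mult_ac)
      qed
    qed
    fix e :: real assume "e > 0"
    \<comment> \<open>The summand \<open>1\<close> covers the case \<open>W = 0\<close>.\<close>
    define e' where "e' = e / (1 + W)"
    have e': "e' > 0" "e' * W \<le> e"
      using \<open>e > 0\<close> W by (auto simp: e'_def field_simps)
    obtain d where d: "d > 0" "\<And>x' y. x' \<in> ball 0 \<rho> \<Longrightarrow> dist x' x < d \<Longrightarrow>
       r \<le> norm y \<Longrightarrow> norm y < R \<Longrightarrow> norm (K' (x' - y) - K' (x - y)) \<le> e'"
      using uc[OF e'(1)] by blast
    show "\<exists>d>0. \<forall>x'. norm (x' - x) < d \<longrightarrow> norm (G x' - G x - D x (x' - x)) \<le> e * norm (x' - x)"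
    proof (intro exI[of _ "min d (\<rho> - norm x)"] conjI allI impI)
      fix x' assume x': "norm (x' - x) < min d (\<rho> - norm x)"
      then have x'\<rho>: "x' \<in> ball 0 \<rho>"
        using norm_triangle_ineq2[of x' x] by simp
      then have x'r: "x' \<in> ball 0 r"
        using \<rho> by simp
      have "G x' - G x - D x (x' - x) =
         (LINT y|lborel. (cauchy_kernel (x' - y) - cauchy_kernel (x - y) - kernel_deriv (x - y) (x' - x)) * w y)"
        using intK[OF x] intK[OF x'r] intD[OF x]
        by (simp add: G[OF x] G[OF x'r] D_def left_diff_distrib)
      also have "norm \<dots> \<le> norm (x' - x) * e' * W"
      proof (rule bound_mult(2))
        fix y :: quat assume y: "r \<le> norm y" "norm y < R"
        have "norm (cauchy_kernel (x' - y) - cauchy_kernel (x - y) - K' (x - y) ((x' - y) - (x - y)))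
          \<le> norm ((x' - y) - (x - y)) * e'"
        proof (rule differentiable_bound_linearization[where f'="\<lambda>z. blinfun_apply (K' z)" and ?x0.0="x - y" and S="(\<lambda>z. z - y) ` (ball 0 \<rho> \<inter> ball x d)"])
          show "(x - y) + t *\<^sub>R ((x' - y) - (x - y)) \<in> (\<lambda>z. z - y) ` (ball 0 \<rho> \<inter> ball x d)" if "t \<in> {0..1}" for t
          proof
            show "(x - y) + t *\<^sub>R ((x' - y) - (x - y)) = (x + t *\<^sub>R (x' - x)) - y"
              by simp
            have "x + t *\<^sub>R (x' - x) \<in> closed_segment x x'"
              unfolding closed_segment_def mem_Collect_eq using that
              by (intro exI[of _ t]) (simp add: algebra_simps)
            moreover have "closed_segment x x' \<subseteq> ball 0 \<rho> \<inter> ball x d"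
              using x'\<rho> x' \<rho> d(1)
              by (intro closed_segment_subset convex_Int convex_ball) (auto simp: dist_norm norm_minus_commute)
            ultimately show "x + t *\<^sub>R (x' - x) \<in> ball 0 \<rho> \<inter> ball x d"
              by blast
          qed
          show "(cauchy_kernel has_derivative K' z) (at z within (\<lambda>z. z - y) ` (ball 0 \<rho> \<inter> ball x d))"
            if "z \<in> (\<lambda>z. z - y) ` (ball 0 \<rho> \<inter> ball x d)" for z
            using that \<rho> nonzero[OF _ y(1)] by (intro has_derivative_at_withinI[OF K'(1)]) auto
          show "onorm (blinfun_apply (K' z) - blinfun_apply (K' (x - y))) \<le> e'" 
            if z: "z \<in> (\<lambda>z. z - y) ` (ball 0 \<rho> \<inter> ball x d)" for z
          proof -
            obtain v where "z = v - y" "v \<in> ball 0 \<rho> \<inter> ball x d"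
              using z by blast
            then have "z = v - y" "v \<in> ball 0 \<rho>" "dist v x < d"
              by (simp_all add: dist_commute)
            then have "norm (K' z - K' (x - y)) \<le> e'"
              using d(2) y by simp
            then show ?thesis
              by (simp add: norm_blinfun.rep_eq minus_blinfun.rep_eq fun_diff_def)
          qed
          show "x - y \<in> (\<lambda>z. z - y) ` (ball 0 \<rho> \<inter> ball x d)"
            using \<rho> d(1) by auto
        qed
        then show "norm (cauchy_kernel (x' - y) - cauchy_kernel (x - y) - kernel_deriv (x - y) (x' - x)) \<le> norm (x' - x) * e'"
          using K'_eq[OF nonzero[OF x y(1)]] by simp
      qed measurable
      also have "norm (x' - x) * e' * W \<le> e * norm (x' - x)"
        using mult_right_mono[OF e'(2) norm_ge_zero[of "x' - x"]] by (simp add: mult_ac)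
      finally show "norm (G x' - G x - D x (x' - x)) \<le> e * norm (x' - x)" .
    qed (use d \<rho> in auto)
  qed

  have "G \<in> C1_on (ball 0 r)"
  proof (rule C1_onI[OF D])
    fix h
    show "continuous_on (ball 0 r) (\<lambda>x. D x h)"
      unfolding continuous_on_iff
    proof (intro ballI allI impI)
      fix x :: quat and e :: real assume x: "x \<in> ball 0 r" and "e > 0"
      obtain \<rho> where \<rho>: "norm x < \<rho>" "\<rho> < r"
        and uc: "\<And>e. e > 0 \<Longrightarrow> \<exists>d>0. \<forall>x'\<in>ball 0 \<rho>. dist x' x < d \<longrightarrow>
         (\<forall>y. r \<le> norm y \<longrightarrow> norm y < R \<longrightarrow> norm (K' (x' - y) - K' (x - y)) \<le> e)"
        using local[OF x] by blast
      define e' where "e' = e / (1 + norm h * W)"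
      have "norm h * W \<ge> 0"
        using W by simp
      then have e': "e' > 0" "e' * norm h * W < e"
        using \<open>e > 0\<close> by (auto simp: e'_def field_simps add_pos_nonneg)
      obtain d where d: "d > 0" "\<And>x' y. x' \<in> ball 0 \<rho> \<Longrightarrow> dist x' x < d \<Longrightarrow>
         r \<le> norm y \<Longrightarrow> norm y < R \<Longrightarrow> norm (K' (x' - y) - K' (x - y)) \<le> e'"
        using uc[OF e'(1)] by blast
      show "\<exists>d>0. \<forall>x'\<in>ball 0 r. dist x' x < d \<longrightarrow> dist (D x' h) (D x h) < e"
      proof (intro exI[of _ "min d (\<rho> - norm x)"] conjI ballI impI)
        fix x' assume x': "x' \<in> ball 0 r" "dist x' x < min d (\<rho> - norm x)"
        then have x'\<rho>: "x' \<in> ball 0 \<rho>"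
          using norm_triangle_ineq2[of x' x] by (simp add: dist_norm)
        have "D x' h - D x h = (LINT y|lborel. (kernel_deriv (x' - y) h - kernel_deriv (x - y) h) * w y)"
          using intD[OF x] intD[OF x'(1)] by (simp add: D_def left_diff_distrib)
        also have "norm \<dots> \<le> e' * norm h * W"
        proof (rule bound_mult(2))
          fix y :: quat assume y: "r \<le> norm y" "norm y < R"
          have "norm ((K' (x' - y) - K' (x - y)) h) \<le> e' * norm h"
            using x' x'\<rho> y by (intro order_trans[OF norm_blinfun] mult_right_mono d) auto
          then show "norm (kernel_deriv (x' - y) h - kernel_deriv (x - y) h) \<le> e' * norm h"
            using K'_eq[OF nonzero[OF x y(1)]] K'_eq[OF nonzero[OF x'(1) y(1)]]
            by (simp add: blinfun.diff_left)
        qed measurable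
        also note e'(2)
        finally show "dist (D x' h) (D x h) < e"
          by (simp add: dist_norm)
      qed (use d \<rho> in auto)
    qed
  qed
  moreover have "fueter G x = 0" if x: "x \<in> ball 0 r" for x
  proof -
    have e: "e * D x h = (LINT y|lborel. e * (kernel_deriv (x - y) h * w y))"
        "integrable lborel (\<lambda>y. e * (kernel_deriv (x - y) h * w y))" for e h
      unfolding D_def using intD[OF x] by simp_all
    have "fueter G x = (LINT y|lborel. fueter_symbol (\<lambda>h. kernel_deriv (x - y) h * w y))"
      unfolding fueter_eq_symbol[OF D[OF x]] fueter_symbol_def e
      using e(2) intD[OF x] by (simp add: D_def)
    then show ?thesis
      by (simp add: fueter_kernel_deriv)
  qed
  ultimately show ?thesis
    by (simp add: hyperholomorphic_def)
qed

section \<open>Cutoff functions and localization\<close>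

text \<open>With \<open>P t = (max 0 t)\<^sup>2\<close>, which is of class \<open>C\<^sup>1\<close>, the quotient
  \<open>P(s\<^sup>2 - t) / (P(s\<^sup>2 - t) + P(t - r\<^sup>2))\<close> passes from \<open>1\<close> to \<open>0\<close> as \<open>t\<close> runs from \<open>r\<^sup>2\<close> to \<open>s\<^sup>2\<close>; its denominator
  is positive because at least one of the two arguments is. The cutoff is its composition with
  \<open>y \<mapsto> |y|\<^sup>2\<close>.\<close>

lemma exists_C1_cutoff:
  assumes "0 < r" "r < s"
  obtains \<phi> :: "quat \<Rightarrow> real" and \<phi>' :: "quat \<Rightarrow> quat \<Rightarrow> real"
  where "\<And>y. (\<phi> has_derivative \<phi>' y) (at y)" "\<And>h. continuous_on UNIV (\<lambda>y. \<phi>' y h)"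
    "\<And>y. norm y \<le> r \<Longrightarrow> \<phi> y = 1" "\<And>y. norm y \<ge> s \<Longrightarrow> \<phi> y = 0"
proof -
  define P where "P t = (max 0 t)\<^sup>2" for t :: real
  have P: "(P has_real_derivative 2 * max 0 t) (at t)" for t
  proof -
    consider "t < 0" | "t > 0" | "t = 0" by linarith
    then show ?thesis
    proof cases
      case 1
      have "((\<lambda>_. 0) has_real_derivative 2 * max 0 t) (at t)"
        using 1 by simp
      then show ?thesis
        by (rule has_field_derivative_transform_within_open[where S="{..<0}"]) (use 1 in \<open>auto simp: P_def\<close>)
    next
      case 2
      have "((\<lambda>t. t\<^sup>2) has_real_derivative 2 * max 0 t) (at t)"
        using 2 by (auto intro!: derivative_eq_intros)
      then show ?thesis
        by (rule has_field_derivative_transform_within_open[where S="{0<..}"]) (use 2 in \<open>auto simp: P_def\<close>)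
    next
      case 3
      have "(\<lambda>h. (P (0 + h) - P 0) / h) \<midarrow>0\<rightarrow> 0"
      proof (rule Lim_null_comparison)
        show "\<forall>\<^sub>F h in at 0. norm ((P (0 + h) - P 0) / h) \<le> \<bar>h\<bar>"
          by (intro always_eventually allI) (auto simp: P_def max_def power2_eq_square)
        show "(\<lambda>h::real. \<bar>h\<bar>) \<midarrow>0\<rightarrow> 0"
          by (rule tendsto_rabs_zero) (rule tendsto_ident_at)
      qed
      then show ?thesis
        using 3 by (simp add: DERIV_def)
    qed
  qed
  define q where "q t = P (s\<^sup>2 - t) + P (t - r\<^sup>2)" for t
  have "r\<^sup>2 < s\<^sup>2"
    using assms by (intro power_strict_mono) auto
  then have q: "q t > 0" for t
    by (cases "t < s\<^sup>2") (auto simp: q_def P_def add_pos_nonneg add_nonneg_pos)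
  define n' where "n' t = - (2 * max 0 (s\<^sup>2 - t))" for t
  define q' where "q' t = n' t + 2 * max 0 (t - r\<^sup>2)" for t
  define \<eta>' where "\<eta>' t = (n' t * q t - P (s\<^sup>2 - t) * q' t) / (q t * q t)" for t
  have n': "((\<lambda>t. P (s\<^sup>2 - t)) has_real_derivative n' t) (at t)" for t
  proof -
    have "((\<lambda>t. s\<^sup>2 - t) has_real_derivative - 1) (at t)"
      by (auto intro!: derivative_eq_intros)
    from DERIV_chain2[OF P this] show ?thesis
      by (simp add: n'_def)
  qed
  have q': "(q has_real_derivative q' t) (at t)" for t
  proof -
    have "((\<lambda>t. t - r\<^sup>2) has_real_derivative 1) (at t)"
      by (auto intro!: derivative_eq_intros)
    from DERIV_add[OF n' DERIV_chain2[OF P this]] show ?thesis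
      by (simp add: q_def[abs_def] q'_def)
  qed
  have \<eta>': "((\<lambda>t. P (s\<^sup>2 - t) / q t) has_real_derivative \<eta>' t) (at t)" for t
    unfolding \<eta>'_def using q[of t] by (intro DERIV_divide n' q') simp
  define \<phi> where "\<phi> y = P (s\<^sup>2 - y \<bullet> y) / q (y \<bullet> y)" for y :: quat
  define \<phi>' where "\<phi>' y h = (2 * (y \<bullet> h)) * \<eta>' (y \<bullet> y)" for y h :: quat
  show thesis
  proof (rule that)
    show "(\<phi> has_derivative \<phi>' y) (at y)" for y
    proof -
      have "((\<lambda>y. y \<bullet> y) has_derivative (\<lambda>h. 2 * (y \<bullet> h))) (at y)"
        by (auto intro!: derivative_eq_intros simp: inner_commute)
      from has_derivative_compose[OF this \<eta>'[unfolded has_field_derivative_def]]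
      show ?thesis
        by (simp add: \<phi>_def[abs_def] \<phi>'_def[abs_def] mult.commute)
    qed
    have "continuous_on UNIV \<eta>'"
      unfolding \<eta>'_def q'_def n'_def q_def P_def
      using q by (intro continuous_intros) (auto simp: q_def P_def less_le)
    then have "continuous_on UNIV (\<lambda>y::quat. \<eta>' (y \<bullet> y))"
      by (rule continuous_on_compose2) (auto intro!: continuous_intros)
    then show "continuous_on UNIV (\<lambda>y. \<phi>' y h)" for h
      unfolding \<phi>'_def by (intro continuous_intros)
    show "\<phi> y = 1" if "norm y \<le> r" for y
    proof -
      have "y \<bullet> y \<le> r\<^sup>2"
        using that by (simp add: dot_square_norm power_mono)
      then show ?thesis
        using q[of "y \<bullet> y"] by (simp add: \<phi>_def q_def P_def)
    qed
    show "\<phi> y = 0" if "norm y \<ge> s" for y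
    proof -
      have "y \<bullet> y \<ge> s\<^sup>2"
        using that assms by (simp add: dot_square_norm power_mono)
      then show ?thesis
        by (simp add: \<phi>_def P_def)
    qed
  qed
qed

text \<open>Real factors commute with the units \<open>e\<^sub>k\<close>, so the usual Leibniz rule holds here. The function \<open>F\<close> is
  controlled only on the unit ball; the unit ball and the complement of the closed ball of radius \<open>s\<close> form
  an open cover, and on the second set the product vanishes.\<close>

lemma fueter_cutoff_times:
  fixes \<phi> :: "quat \<Rightarrow> real" and F :: "quat \<Rightarrow> quat"
  assumes \<phi>: "\<And>y. (\<phi> has_derivative \<phi>' y) (at y)" "\<And>h. continuous_on UNIV (\<lambda>y. \<phi>' y h)"
    and zero: "\<And>y. norm y \<ge> s \<Longrightarrow> \<phi> y = 0" and "s < 1"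
    and F: "F \<in> C1_on (ball 0 1)"
  shows "(\<lambda>y. \<phi> y *\<^sub>R F y) \<in> C1_on UNIV"
    and "norm y < 1 \<Longrightarrow> fueter (\<lambda>y. \<phi> y *\<^sub>R F y) y =
      fueter_symbol (\<lambda>h. of_real (\<phi>' y h)) * F y + \<phi> y *\<^sub>R fueter F y"
    and "norm y > s \<Longrightarrow> fueter (\<lambda>y. \<phi> y *\<^sub>R F y) y = 0"
proof -
  obtain F' :: "quat \<Rightarrow> quat \<Rightarrow>\<^sub>L quat"
    where F': "\<And>y. y \<in> ball 0 1 \<Longrightarrow> (F has_derivative F' y) (at y)" "continuous_on (ball 0 1) F'"
    using F unfolding C1_on_def by blast
  define D where "D y h = (if norm y < 1 then \<phi> y *\<^sub>R F' y h + \<phi>' y h *\<^sub>R F y else 0)" for y h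
  have out: "((\<lambda>y. \<phi> y *\<^sub>R F y) has_derivative (\<lambda>_. 0)) (at y)" if "norm y > s" for y
    by (rule has_derivative_transform_within_open[where f="\<lambda>_. 0" and s="- cball 0 s"])
      (use that zero in auto)
  have ins: "((\<lambda>y. \<phi> y *\<^sub>R F y) has_derivative D y) (at y)" if "norm y < 1" for y
    using has_derivative_scaleR[OF \<phi>(1) F'(1)[of y]] that by (simp add: D_def[abs_def])
  have D: "((\<lambda>y. \<phi> y *\<^sub>R F y) has_derivative D y) (at y)" for y
  proof (cases "norm y < 1")
    case False
    then show ?thesis
      using out[of y] \<open>s < 1\<close> by (simp add: D_def[abs_def])
  qed (rule ins)
  have D_out: "D y h = 0" if "norm y > s" for y h
    using has_derivative_unique[OF D out[OF that]] by (rule fun_cong)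
  show "(\<lambda>y. \<phi> y *\<^sub>R F y) \<in> C1_on UNIV"
  proof (rule C1_onI[OF D])
    fix h
    have "continuous_on UNIV \<phi>"
      using \<phi>(1) by (auto intro!: continuous_at_imp_continuous_on intro: has_derivative_continuous)
    then have "continuous_on (ball 0 1) (\<lambda>y. \<phi> y *\<^sub>R F' y h + \<phi>' y h *\<^sub>R F y)"
      using \<phi>(2) F'(2) C1_on_imp_continuous_on[OF F]
      by (intro continuous_intros) (auto intro: continuous_on_subset)
    then have 1: "continuous_on (ball 0 1) (\<lambda>y. D y h)"
      by (rule continuous_on_eq) (simp add: D_def)
    have 2: "continuous_on (- cball 0 s) (\<lambda>y. D y h)"
      by (rule continuous_on_eq[OF continuous_on_const[of _ 0]]) (simp add: D_out)
    have "continuous_on (ball 0 1 \<union> - cball 0 s) (\<lambda>y. D y h)"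
      by (intro continuous_on_open_Un 1 2) auto
    moreover have "ball 0 1 \<union> - cball 0 s = (UNIV :: quat set)"
      using \<open>s < 1\<close> by auto
    ultimately show "continuous_on UNIV (\<lambda>y. D y h)"
      by simp
  qed
  show "fueter (\<lambda>y. \<phi> y *\<^sub>R F y) y = 0" if "norm y > s"
    using fueter_eq_symbol[OF out[OF that]] by (simp add: fueter_symbol_def)
  show "fueter (\<lambda>y. \<phi> y *\<^sub>R F y) y =
      fueter_symbol (\<lambda>h. of_real (\<phi>' y h)) * F y + \<phi> y *\<^sub>R fueter F y" if "norm y < 1"
    using that fueter_eq_symbol[OF D[of y]] fueter_eq_symbol[OF F'(1)[of y]]
    by (simp add: fueter_symbol_def D_def of_real_def algebra_simps)
qed

lemma hyperholomorphic_if_smaller_balls: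
  assumes "\<And>r. 0 < r \<Longrightarrow> r < 1 \<Longrightarrow> f \<in> hyperholomorphic (ball 0 r)"
  shows "f \<in> hyperholomorphic (ball 0 1)"
proof -
  have ex: "\<exists>r. 0 < r \<and> r < 1 \<and> x \<in> ball 0 r" if "x \<in> ball 0 1" for x :: quat
    using dense[of "norm x" 1] that norm_ge_zero[of x]
    by (metis mem_ball_0 le_less_trans)
  define D where "D x = frechet_derivative f (at x)" for x
  have D: "(f has_derivative D x) (at x)" if "x \<in> ball 0 1" for x
  proof -
    from ex[OF that] obtain r where r: "0 < r" "r < 1" "x \<in> ball 0 r"
      by blast
    have "f differentiable (at x)"
      using assms[OF r(1,2)] r(3) unfolding hyperholomorphic_def C1_on_def differentiable_def by blast
    then show ?thesis
      by (simp add: D_def frechet_derivative_works)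
  qed
  have "f \<in> C1_on (ball 0 1)"
  proof (rule C1_onI[OF D])
    fix h
    show "continuous_on (ball 0 1) (\<lambda>x. D x h)"
    proof (intro continuous_at_imp_continuous_on ballI)
      fix x :: quat assume "x \<in> ball 0 1"
      from ex[OF this] obtain r where r: "0 < r" "r < 1" "x \<in> ball 0 r"
        by blast
      obtain f' :: "quat \<Rightarrow> quat \<Rightarrow>\<^sub>L quat"
        where f': "\<And>x. x \<in> ball 0 r \<Longrightarrow> (f has_derivative f' x) (at x)" "continuous_on (ball 0 r) f'"
        using assms[OF r(1,2)] unfolding hyperholomorphic_def C1_on_def by blast
      have "continuous_on (ball 0 r) (\<lambda>x. f' x h)"
        by (intro continuous_intros f')
      then have "continuous_on (ball 0 r) (\<lambda>x. D x h)"
      proof (rule continuous_on_eq)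
        fix x :: quat assume x: "x \<in> ball 0 r"
        then have "x \<in> ball 0 1"
          using r by simp
        from has_derivative_unique[OF f'(1)[OF x] D[OF this]] show "f' x h = D x h"
          by (rule fun_cong)
      qed
      then show "isCont (\<lambda>x. D x h) x"
        using r by (simp add: continuous_on_eq_continuous_at)
    qed
  qed
  moreover have "fueter f x = 0" if "x \<in> ball 0 1" for x
    using ex[OF that] assms by (auto simp: hyperholomorphic_def)
  ultimately show ?thesis
    by (simp add: hyperholomorphic_def)
qed

section \<open>The functions \<open>\<xi>\<^sub>n\<close> and uniform limits\<close>

lemma bounded_indicator_ball_continuous:
  fixes g :: "quat \<Rightarrow> quat"
  assumes "continuous_on UNIV g"
  obtains B where "\<And>y. norm (indicator (ball 0 1) y *\<^sub>R g y) \<le> B"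
proof -
  have "bounded (g ` cball 0 1)"
    by (intro compact_imp_bounded compact_continuous_image continuous_on_subset[OF assms]) auto
  then obtain B where B: "\<And>y. y \<in> cball 0 1 \<Longrightarrow> norm (g y) \<le> B"
    unfolding bounded_iff by blast
  have "norm (indicator (ball 0 1) y *\<^sub>R g y) \<le> max B 0" for y
    using B[of y] by (auto simp: indicator_def)
  then show thesis
    by (rule that)
qed

lemma measurable_indicator_ball_continuous:
  fixes g :: "quat \<Rightarrow> quat"
  assumes "continuous_on UNIV g"
  shows "(\<lambda>y. indicator (ball 0 1) y *\<^sub>R g y) \<in> borel_measurable lborel"
  using borel_measurable_continuous_onI[OF assms]
  by (auto intro!: borel_measurable_scaleR borel_measurable_indicator)

lemma integrable_indicator_ball_continuous:
  fixes g :: "quat \<Rightarrow> quat"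
  assumes "continuous_on UNIV g"
  shows "integrable lborel (\<lambda>y. indicator (ball 0 1) y *\<^sub>R g y)"
proof -
  obtain B where B: "\<And>y. norm (indicator (ball 0 1) y *\<^sub>R g y) \<le> B"
    using bounded_indicator_ball_continuous[OF assms] by blast
  show ?thesis
  proof (rule Bochner_Integration.integrable_bound)
    show "integrable lborel (\<lambda>y::quat. indicator (ball 0 1) y * B)"
      by (intro integrable_mult_left integrable_real_indicator emeasure_lborel_ball_finite) simp
    show "AE y in lborel. norm (indicator (ball 0 1) y *\<^sub>R g y) \<le> norm (indicator (ball 0 1) y * B)"
    proof (rule AE_I2)
      fix y
      show "norm (indicator (ball 0 1) y *\<^sub>R g y) \<le> norm (indicator (ball 0 1) y * B)"
        using B[of y] by (cases "y \<in> ball 0 1") auto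
    qed
  qed (rule measurable_indicator_ball_continuous[OF assms])
qed

lemma integrable_teodorescu:
  assumes "continuous_on UNIV g"
  shows "integrable lborel (\<lambda>y. cauchy_kernel (x - y) * (indicator (ball 0 1) y *\<^sub>R g y))"
proof -
  obtain B where "\<And>y. norm (indicator (ball 0 1) y *\<^sub>R g y) \<le> B"
    using bounded_indicator_ball_continuous[OF assms] by blast
  then show ?thesis
  proof (rule integrable_kernel_times[where R="norm x + 1", rotated])
    show "indicator (ball 0 1) y *\<^sub>R g y = 0" if "y \<notin> ball x (norm x + 1)" for y
      using that norm_triangle_ineq4[of x y] by (auto simp: dist_norm indicator_def)
  qed (rule measurable_indicator_ball_continuous[OF assms])
qed

lemma teodorescu_eq:
  "teodorescu g x = (LINT y|lborel. cauchy_kernel (x - y) * (indicator (ball 0 1) y *\<^sub>R g y))"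
  by (simp add: teodorescu_def set_lebesgue_integral_def)

lemma teodorescu_add:
  assumes "continuous_on UNIV f" "continuous_on UNIV g"
  shows "teodorescu (\<lambda>y. f y + g y) x = teodorescu f x + teodorescu g x"
  unfolding teodorescu_eq scaleR_add_right distrib_left
  by (intro Bochner_Integration.integral_add integrable_teodorescu assms)

lemma teodorescu_scaleR: "teodorescu (\<lambda>y. c *\<^sub>R g y) x = c *\<^sub>R teodorescu g x"
  unfolding teodorescu_eq by (subst integral_scaleR_right[symmetric]) (simp add: mult.commute)

lemma teodorescu_sum:
  assumes "\<And>k. k \<in> A \<Longrightarrow> continuous_on UNIV (g k)"
  shows "teodorescu (\<lambda>y. \<Sum>k\<in>A. g k y) x = (\<Sum>k\<in>A. teodorescu (g k) x)"
  unfolding teodorescu_eq scaleR_sum_right sum_distrib_left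
  by (intro Bochner_Integration.integral_sum integrable_teodorescu assms)

text \<open>Linearity merges the integrals in the definition of \<open>\<xi>\<^sub>n\<close> into one. The formula includes
  \<open>n = 0\<close>, for which the sum is empty.\<close>

lemma xi_eq:
  "xi n x = qvec x * x ^ n +
    teodorescu (\<lambda>y. - 2 * qvec y * (\<Sum>k=1..n. qcnj y ^ (k - 1) * y ^ (n - k)) + 3 * y ^ n) x"
proof -
  note [continuous_intros] = linear_continuous_on[OF bounded_linear_qvec]
    linear_continuous_on[OF bounded_linear_qcnj]
  have numeral_scaleR: "numeral k * v = numeral k *\<^sub>R v" for k and v :: quat
    by (simp add: scaleR_conv_of_real)
  have "teodorescu (\<lambda>y. - 2 * qvec y * (\<Sum>k=1..n. qcnj y ^ (k - 1) * y ^ (n - k)) + 3 * y ^ n) x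
    = teodorescu (\<lambda>y. (- 2) *\<^sub>R (\<Sum>k=1..n. qvec y * qcnj y ^ (k - 1) * y ^ (n - k)) + 3 *\<^sub>R y ^ n) x"
    by (simp add: numeral_scaleR sum_distrib_left scaleR_sum_right sum_negf mult.assoc)
  also have "\<dots> = (- 2) *\<^sub>R (\<Sum>k=1..n. teodorescu (\<lambda>y. qvec y * qcnj y ^ (k - 1) * y ^ (n - k)) x)
      + 3 *\<^sub>R teodorescu (\<lambda>y. y ^ n) x"
  proof -
    have 1: "continuous_on UNIV (\<lambda>y. (- 2) *\<^sub>R (\<Sum>k=1..n. qvec y * qcnj y ^ (k - 1) * y ^ (n - k)))"
      by (intro continuous_intros)
    have 2: "continuous_on UNIV (\<lambda>y::quat. 3 *\<^sub>R y ^ n)"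
      by (intro continuous_intros)
    have 3: "continuous_on UNIV (\<lambda>y. qvec y * qcnj y ^ (k - 1) * y ^ (n - k))" for k
      by (intro continuous_intros)
    show ?thesis
      by (simp only: teodorescu_add[OF 1 2] teodorescu_scaleR teodorescu_sum[OF 3])
  qed
  finally show ?thesis
    by (simp add: xi_def numeral_scaleR)
qed

text \<open>By the Cauchy--Pompeiu formula for \<open>u = \<phi> h\<close>, the function \<open>\<xi>\<^sub>n\<close> coincides on the ball of radius \<open>r\<close> with the
  potential of a density that vanishes on that ball.\<close>

theorem hyperholomorphic_xi: "xi n \<in> hyperholomorphic (ball 0 1)"
proof (rule hyperholomorphic_if_smaller_balls)
  fix r :: real assume r: "0 < r" "r < 1"
  define h where "h y = qvec y * y ^ n" for y :: quat
  define s where "s = (r + 1) / 2"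
  have s: "r < s" "s < 1"
    using r by (auto simp: s_def)
  obtain \<phi> :: "quat \<Rightarrow> real" and \<phi>' :: "quat \<Rightarrow> quat \<Rightarrow> real"
    where \<phi>: "\<And>y. (\<phi> has_derivative \<phi>' y) (at y)" "\<And>h. continuous_on UNIV (\<lambda>y. \<phi>' y h)"
      "\<And>y. norm y \<le> r \<Longrightarrow> \<phi> y = 1" "\<And>y. norm y \<ge> s \<Longrightarrow> \<phi> y = 0"
    using exists_C1_cutoff[OF r(1) s(1)] by blast
  define u where "u y = \<phi> y *\<^sub>R h y" for y
  have h: "h \<in> C1_on S" for S
    unfolding h_def[abs_def] by (rule C1_on_qvec_power)
  note cut = fueter_cutoff_times[OF \<phi>(1,2,4) s(2) h, folded u_def]
  have cont: "continuous_on UNIV (\<lambda>y. fueter u y - fueter h y)" "continuous_on UNIV (\<lambda>y. - fueter h y)"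
    using continuous_on_fueter[OF cut(1)] continuous_on_fueter[OF h[of UNIV]]
    by (simp_all add: continuous_on_diff continuous_on_minus)
  have u_h: "u y = h y" if "norm y \<le> r" for y
    using that \<phi>(3) by (simp add: u_def)
  show "xi n \<in> hyperholomorphic (ball 0 r)"
  proof (rule kernel_potential_hyperholomorphic[where R=1])
    show "integrable lborel (\<lambda>y. indicator (ball 0 1) y *\<^sub>R (fueter u y - fueter h y))"
      using cont(1) by (rule integrable_indicator_ball_continuous)
    show "indicator (ball 0 1) y *\<^sub>R (fueter u y - fueter h y) = 0" if "norm y < r" for y
    proof -
      obtain D where D: "(h has_derivative D) (at y)"
        using h[of UNIV] by (auto simp: C1_on_def)
      then have "(u has_derivative D) (at y)"
        by (rule has_derivative_transform_within_open[where s="ball 0 r"]) (use that u_h in auto)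
      then show ?thesis
        using D by (simp add: fueter_eq_symbol)
    qed
    show "indicator (ball 0 1) y *\<^sub>R (fueter u y - fueter h y) = 0" if "norm y \<ge> 1" for y
      using that by simp
    fix x :: quat assume x: "x \<in> ball 0 r"
    have u: "has_bochner_integral lborel (\<lambda>y. cauchy_kernel (x - y) * fueter u y) (u x)"
      using \<phi>(4) by (intro cauchy_pompeiu_compact_support[OF cut(1)]) (auto simp: u_def)
    have "xi n x = u x + teodorescu (\<lambda>y. - fueter h y) x"
      using u_h[of x] x by (simp add: xi_eq h_def[abs_def] fueter_qvec_power)
    also have "\<dots> = (LINT y|lborel. cauchy_kernel (x - y) * fueter u y
        + cauchy_kernel (x - y) * (indicator (ball 0 1) y *\<^sub>R - fueter h y))"
      using u integrable_teodorescu[OF cont(2), of x]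
      by (simp add: has_bochner_integral_iff teodorescu_eq)
    also have "\<dots> = (LINT y|lborel. cauchy_kernel (x - y) * (indicator (ball 0 1) y *\<^sub>R (fueter u y - fueter h y)))"
    proof (rule Bochner_Integration.integral_cong[OF refl])
      fix y
      have "fueter u y = 0" if "y \<notin> ball 0 1"
        using that s(2) by (intro cut(3)) auto
      then show "cauchy_kernel (x - y) * fueter u y
          + cauchy_kernel (x - y) * (indicator (ball 0 1) y *\<^sub>R - fueter h y) =
        cauchy_kernel (x - y) * (indicator (ball 0 1) y *\<^sub>R (fueter u y - fueter h y))"
        by (cases "y \<in> ball 0 1") (simp_all add: algebra_simps)
    qed
    finally show "xi n x = \<dots>" .
  qed
qed

text \<open>The analogue of Weierstrass' convergence theorem. The formula
  \<open>F\<^sub>n(x) = \<integral> K(x - y) d(y) F\<^sub>n(y) dy\<close> with \<open>d = D \<phi>\<close> passes to the limit by dominated convergence.\<close>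

theorem hyperholomorphic_uniform_limit:
  fixes F :: "nat \<Rightarrow> quat \<Rightarrow> quat"
  assumes F: "\<And>n. F n \<in> hyperholomorphic (ball 0 1)"
    and lim: "\<And>s. s < 1 \<Longrightarrow> uniform_limit (cball 0 s) F G sequentially"
  shows "G \<in> hyperholomorphic (ball 0 1)"
proof (rule hyperholomorphic_if_smaller_balls)
  fix r :: real assume r: "0 < r" "r < 1"
  define s where "s = (r + 1) / 2"
  have s: "r < s" "s < 1"
    using r by (auto simp: s_def)
  obtain \<phi> :: "quat \<Rightarrow> real" and \<phi>' :: "quat \<Rightarrow> quat \<Rightarrow> real"
    where \<phi>: "\<And>y. (\<phi> has_derivative \<phi>' y) (at y)" "\<And>h. continuous_on UNIV (\<lambda>y. \<phi>' y h)"
      "\<And>y. norm y \<le> r \<Longrightarrow> \<phi> y = 1" "\<And>y. norm y \<ge> s \<Longrightarrow> \<phi> y = 0"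
    using exists_C1_cutoff[OF r(1) s(1)] by blast
  have FC: "F n \<in> C1_on (ball 0 1)" and F0: "\<And>x. x \<in> ball 0 1 \<Longrightarrow> fueter (F n) x = 0" for n
    using F[of n] by (auto simp: hyperholomorphic_def)
  define d where "d y = fueter_symbol (\<lambda>h. of_real (\<phi>' y h))" for y
  note cut = fueter_cutoff_times[OF \<phi>(1,2,4) s(2) FC, folded d_def]
  have d_in: "d y = 0" if "norm y < r" for y
  proof -
    have "(\<phi> has_derivative (\<lambda>_. 0)) (at y)"
      by (rule has_derivative_transform_within_open[where f="\<lambda>_. 1" and s="ball 0 r"]) (use that \<phi>(3) in auto)
    from has_derivative_unique[OF \<phi>(1) this] show ?thesis
      by (simp add: d_def fueter_symbol_def)
  qed
  have d_out: "d y = 0" if "norm y > s" for y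
  proof -
    have "(\<phi> has_derivative (\<lambda>_. 0)) (at y)"
      by (rule has_derivative_transform_within_open[where f="\<lambda>_. 0" and s="- cball 0 s"]) (use that \<phi>(4) in auto)
    from has_derivative_unique[OF \<phi>(1) this] show ?thesis
      by (simp add: d_def fueter_symbol_def)
  qed
  \<comment> \<open>Outside the unit ball nothing is known about \<open>F n\<close>, but there both sides vanish.\<close>
  have fueter_u: "fueter (\<lambda>y. \<phi> y *\<^sub>R F n y) y = d y * F n y" for n y
    using cut(2)[of y n] cut(3)[of y n] F0[of y n] d_out[of y] s(2)
    by (cases "norm y < 1") auto
  have rep: "has_bochner_integral lborel (\<lambda>y. cauchy_kernel (x - y) * (d y * F n y)) (F n x)"
    if "x \<in> ball 0 r" for n x
  proof -
    have "has_bochner_integral lborel (\<lambda>y. cauchy_kernel (x - y) * fueter (\<lambda>y. \<phi> y *\<^sub>R F n y) y) (\<phi> x *\<^sub>R F n x)"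
      using \<phi>(4) by (intro cauchy_pompeiu_compact_support[OF cut(1)]) auto
    then show ?thesis
      using \<phi>(3)[of x] that by (simp add: fueter_u)
  qed
  have meas_n: "(\<lambda>y. d y * F n y) \<in> borel_measurable lborel" for n
  proof -
    have "fueter (\<lambda>y. \<phi> y *\<^sub>R F n y) = (\<lambda>y. d y * F n y)"
      using fueter_u by (rule ext)
    then show ?thesis
      using borel_measurable_continuous_onI[OF continuous_on_fueter[OF cut(1)[of n]]] by simp
  qed
  have lim_w: "(\<lambda>n. d y * F n y) \<longlonglongrightarrow> d y * G y" for y
  proof (cases "norm y \<le> s")
    case True
    then have "(\<lambda>n. F n y) \<longlonglongrightarrow> G y"
      using tendsto_uniform_limitI[OF lim[OF s(2)]] by simp
    then show ?thesis
      by (intro tendsto_mult tendsto_const)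
  qed (simp add: d_out)
  have meas: "(\<lambda>y. d y * G y) \<in> borel_measurable lborel"
    using lim_w meas_n by (rule borel_measurable_LIMSEQ_metric[rotated])
  have "continuous_on (cball 0 s) G"
  proof (rule uniform_limit_theorem[OF _ lim[OF s(2)]])
    show "\<forall>\<^sub>F n in sequentially. continuous_on (cball 0 s) (F n)"
      using s(2) by (intro always_eventually allI continuous_on_subset[OF C1_on_imp_continuous_on[OF FC]]) auto
  qed simp
  then have "bounded (G ` cball 0 s)"
    by (intro compact_imp_bounded compact_continuous_image) auto
  then obtain A where A: "\<And>y. y \<in> cball 0 s \<Longrightarrow> norm (G y) \<le> A"
    unfolding bounded_iff by blast
  have "continuous_on UNIV d"
    unfolding d_def fueter_symbol_def by (intro continuous_intros \<phi>(2))
  then have "bounded (d ` cball 0 s)"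
    by (intro compact_imp_bounded compact_continuous_image) (auto intro: continuous_on_subset)
  then obtain B where B: "\<And>y. y \<in> cball 0 s \<Longrightarrow> norm (d y) \<le> B"
    unfolding bounded_iff by blast
  have "\<forall>\<^sub>F n in sequentially. \<forall>y\<in>cball 0 s. dist (F n y) (G y) < 1"
    using lim[OF s(2)] by (rule uniform_limitD) simp
  then obtain N where N: "\<And>n y. n \<ge> N \<Longrightarrow> y \<in> cball 0 s \<Longrightarrow> dist (F n y) (G y) < 1"
    unfolding eventually_sequentially by blast
  \<comment> \<open>The bound \<open>|F n| \<le> A + 1\<close> holds from the index \<open>N\<close> on, so the sequence is shifted by \<open>N\<close>.\<close>
  define M where "M y = B * (A + 1) * indicator (cball 0 s) y" for y :: quat
  have bound_prod: "norm (d y * v) \<le> M y" if "y \<in> cball 0 s \<Longrightarrow> norm v \<le> A + 1" for y v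
  proof (cases "y \<in> cball 0 s")
    case True
    have "norm (d y) * norm v \<le> B * (A + 1)"
      using B[OF True] that[OF True] order_trans[OF norm_ge_zero B[OF True]] by (intro mult_mono) auto
    then show ?thesis
      using True by (simp add: M_def norm_mult)
  next
    case False
    then show ?thesis
      using d_out[of y] by (simp add: M_def)
  qed
  have bound_n: "norm (d y * F (n + N) y) \<le> M y" for n y
  proof (rule bound_prod)
    assume y: "y \<in> cball 0 s"
    have "norm (F (n + N) y) \<le> norm (G y) + dist (F (n + N) y) (G y)"
      using norm_triangle_ineq[of "G y" "F (n + N) y - G y"] by (simp add: dist_norm)
    then show "norm (F (n + N) y) \<le> A + 1"
      using N[of "n + N" y] A[OF y] y by simp
  qed
  have bound: "norm (d y * G y) \<le> M y" for y
    by (rule bound_prod) (use A[of y] in simp)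
  have intM: "integrable lborel M"
    unfolding M_def by (intro integrable_mult_right integrable_real_indicator) (simp_all add: emeasure_lborel_cball_finite[simplified])
  show "G \<in> hyperholomorphic (ball 0 r)"
  proof (rule kernel_potential_hyperholomorphic[where R=1])
    show "integrable lborel (\<lambda>y. d y * G y)"
      using intM meas by (rule Bochner_Integration.integrable_bound)
        (use order_trans[OF bound abs_ge_self] in auto)
    show "d y * G y = 0" if "norm y < r" for y
      using d_in[OF that] by simp
    show "d y * G y = 0" if "norm y \<ge> 1" for y
      using d_out[of y] that s(2) by simp
    fix x :: quat assume x: "x \<in> ball 0 r"
    have "(\<lambda>n. LINT y|lborel. cauchy_kernel (x - y) * (d y * F (n + N) y))
        \<longlonglongrightarrow> (LINT y|lborel. cauchy_kernel (x - y) * (d y * G y))"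
    proof (rule integral_dominated_convergence)
      have "integrable lborel (\<lambda>y. cauchy_kernel (x - y) * of_real (M y))"
      proof (rule integrable_kernel_times[where B="\<bar>B * (A + 1)\<bar>" and R="norm x + 1"])
        show "(\<lambda>y. of_real (M y) :: quat) \<in> borel_measurable lborel"
          unfolding of_real_def
          by (intro borel_measurable_scaleR borel_measurable_integrable[OF intM] borel_measurable_const)
        show "norm (of_real (M y) :: quat) \<le> \<bar>B * (A + 1)\<bar>" for y
          unfolding norm_of_real by (auto simp: M_def indicator_def)
        show "of_real (M y) = (0::quat)" if "y \<notin> ball x (norm x + 1)" for y
          using that norm_triangle_ineq4[of x y] s(2) by (auto simp: M_def dist_norm indicator_def)
      qed
      then show "integrable lborel (\<lambda>y. norm (cauchy_kernel (x - y) * of_real (M y)))"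
        by (rule integrable_norm)
      show "AE y in lborel. (\<lambda>n. cauchy_kernel (x - y) * (d y * F (n + N) y)) \<longlonglongrightarrow> cauchy_kernel (x - y) * (d y * G y)"
        by (intro AE_I2 tendsto_mult[OF tendsto_const] LIMSEQ_ignore_initial_segment lim_w)
      show "AE y in lborel. norm (cauchy_kernel (x - y) * (d y * F (n + N) y))
          \<le> norm (cauchy_kernel (x - y) * of_real (M y))" for n
        using order_trans[OF bound_n abs_ge_self]
        by (intro AE_I2) (simp add: norm_mult[of "cauchy_kernel _"] mult_left_mono del: norm_mult)
      show "(\<lambda>y. cauchy_kernel (x - y) * (d y * F (n + N) y)) \<in> borel_measurable lborel" for n
        using rep[OF x] by (rule borel_measurable_has_bochner_integral)
      show "(\<lambda>y. cauchy_kernel (x - y) * (d y * G y)) \<in> borel_measurable lborel"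
        by (intro borel_measurable_times meas) measurable
    qed
    then have "(\<lambda>n. F (n + N) x) \<longlonglongrightarrow> (LINT y|lborel. cauchy_kernel (x - y) * (d y * G y))"
      using has_bochner_integral_integral_eq[OF rep[OF x]] by simp
    moreover have "(\<lambda>n. F (n + N) x) \<longlonglongrightarrow> G x"
      using x tendsto_uniform_limitI[OF lim[OF r(2)]] by (intro LIMSEQ_ignore_initial_segment) simp
    ultimately show "G x = (LINT y|lborel. cauchy_kernel (x - y) * (d y * G y))"
      by (rule LIMSEQ_unique[rotated])
  qed
qed

section \<open>The series\<close>

lemma hyperholomorphic_sum_right_mult:
  assumes "finite A" "\<And>n. n \<in> A \<Longrightarrow> f n \<in> hyperholomorphic S"
  shows "(\<lambda>x. \<Sum>n\<in>A. f n x * c n) \<in> hyperholomorphic S"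
  using assms
proof (induction A rule: finite_induct)
  case empty
  have "fueter (\<lambda>_. 0) x = 0" for x
    using fueter_eq_symbol[OF has_derivative_const[of 0 "at x"]] by (simp add: fueter_symbol_def)
  then show ?case
    using C1_on_linear[OF bounded_linear_zero, of S] by (simp add: hyperholomorphic_def)
next
  case (insert m A)
  have m: "f m \<in> hyperholomorphic S" and IH: "(\<lambda>x. \<Sum>n\<in>A. f n x * c n) \<in> hyperholomorphic S"
    using insert by simp_all
  obtain f' :: "quat \<Rightarrow> quat \<Rightarrow>\<^sub>L quat"
    where f: "\<And>x. x \<in> S \<Longrightarrow> (f m has_derivative f' x) (at x)" "continuous_on S f'"
    using m unfolding hyperholomorphic_def C1_on_def by blast
  obtain g' :: "quat \<Rightarrow> quat \<Rightarrow>\<^sub>L quat"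
    where g: "\<And>x. x \<in> S \<Longrightarrow> ((\<lambda>x. \<Sum>n\<in>A. f n x * c n) has_derivative g' x) (at x)" "continuous_on S g'"
    using IH unfolding hyperholomorphic_def C1_on_def by blast
  have D: "((\<lambda>x. \<Sum>n\<in>insert m A. f n x * c n) has_derivative (\<lambda>h. f' x h * c m + g' x h)) (at x)"
    if "x \<in> S" for x
    using has_derivative_add[OF has_derivative_mult_left[OF f(1)[OF that], of "c m"] g(1)[OF that]] insert.hyps
    by simp
  have "(\<lambda>x. \<Sum>n\<in>insert m A. f n x * c n) \<in> C1_on S"
    by (rule C1_onI[OF D]) (assumption, intro continuous_intros f g)
  moreover have "fueter (\<lambda>x. \<Sum>n\<in>insert m A. f n x * c n) x = 0" if "x \<in> S" for x
  proof -
    have "fueter_symbol (\<lambda>h. f' x h * c m + g' x h)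
        = fueter_symbol (f' x) * c m + fueter_symbol (g' x)"
      by (simp add: fueter_symbol_def algebra_simps)
    also have "\<dots> = fueter (f m) x * c m + fueter (\<lambda>x. \<Sum>n\<in>A. f n x * c n) x"
      using that by (simp add: fueter_eq_symbol[OF f(1)] fueter_eq_symbol[OF g(1)])
    also have "\<dots> = 0"
      using m IH that by (simp add: hyperholomorphic_def)
    finally show ?thesis
      by (simp add: fueter_eq_symbol[OF D[OF that]])
  qed
  ultimately show ?case
    by (simp add: hyperholomorphic_def)
qed

text \<open>Evaluating the series at a real point \<open>t\<close> with \<open>s < t < 1\<close> shows that \<open>\<Sum> |a\<^sub>n| s\<^sup>n\<close> converges; real points
  commute with the coefficients, so the usual power series argument applies.\<close>

lemma uniform_convergence_qvec_power_series:
  fixes a :: "nat \<Rightarrow> quat"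
  assumes "\<And>x. x \<in> ball 0 1 \<Longrightarrow> summable (\<lambda>n. x ^ n * a n)" and "s < 1"
  shows "uniformly_convergent_on (cball 0 s) (\<lambda>N x. \<Sum>n<N. qvec x * x ^ n * a n)"
proof (cases "s < 0")
  case True
  then show ?thesis by simp
next
  case False
  obtain t where t: "s < t" "t < 1"
    using dense[OF \<open>s < 1\<close>] by blast
  have "of_real t ^ n * a n = a n * of_real t ^ n" for n
    unfolding of_real_power[symmetric]
    by (simp only: of_real_def mult_scaleR_left mult_scaleR_right mult_1_left mult_1_right)
  then have "summable (\<lambda>n. a n * of_real t ^ n)"
    using assms(1)[of "of_real t"] t False by simp
  then have *: "summable (\<lambda>n. norm (a n * of_real s ^ n))"
    using t False by (intro powser_insidea[of a "of_real t"]) auto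
  show ?thesis
  proof (rule Weierstrass_m_test'[OF _ *])
    fix n and x :: quat assume "x \<in> cball 0 s"
    then have x: "norm x \<le> s" by simp
    have "norm (qvec x) \<le> 1"
    proof -
      have "norm (qvec x) \<le> norm x"
        by (simp add: norm_quat)
      then show ?thesis
        using x \<open>s < 1\<close> by simp
    qed
    then have "norm (qvec x) * norm x ^ n * norm (a n) \<le> 1 * s ^ n * norm (a n)"
      using x False by (intro mult_mono mult_right_mono power_mono) auto
    then show "norm (qvec x * x ^ n * a n) \<le> norm (a n * of_real s ^ n)"
      using False by (simp add: norm_mult norm_power mult.commute)
  qed
qed

theorem proposition3p18:
  fixes f :: "quat \<Rightarrow> quat" and a :: "nat \<Rightarrow> quat"
  assumes "f \<in> slice_regular (ball 0 1)"
    and "\<And>x. x \<in> ball 0 1 \<Longrightarrow> (\<lambda>n. x ^ n * a n) sums f x"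
    and "\<And>K. compact K \<Longrightarrow> K \<subseteq> ball 0 1 \<Longrightarrow>
      uniformly_convergent_on K (\<lambda>N x. \<Sum>n=1..N.
        teodorescu (\<lambda>y. - 2 * qvec y * (\<Sum>k=1..n. qcnj y ^ (k - 1) * y ^ (n - k)) + 3 * y ^ n) x
          * a n)"
  shows "(\<forall>x\<in>ball 0 1. summable (\<lambda>n. xi n x * a n)) \<and>
    (\<lambda>x. \<Sum>n. xi n x * a n) \<in> hyperholomorphic (ball 0 1)"
proof -
  define T where "T n x = teodorescu (\<lambda>y. - 2 * qvec y *
    (\<Sum>k=1..n. qcnj y ^ (k - 1) * y ^ (n - k)) + 3 * y ^ n) x" for n x
  \<comment> \<open>The index is shifted because the partial sums in the hypothesis include the term \<open>n = N\<close>.\<close>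
  define F where "F N x = (\<Sum>n<Suc N. xi n x * a n)" for N x
  have F_eq: "F N x = (\<Sum>n<Suc N. qvec x * x ^ n * a n) + (T 0 x * a 0 + (\<Sum>n=1..N. T n x * a n))" for N x
  proof -
    have "(\<Sum>n<Suc N. T n x * a n) = T 0 x * a 0 + (\<Sum>n=1..N. T n x * a n)"
      by (simp add: lessThan_Suc_atMost atMost_atLeast0 sum.atLeast_Suc_atMost)
    moreover have "xi n x * a n = qvec x * x ^ n * a n + T n x * a n" for n
      unfolding xi_eq T_def by (rule distrib_right)
    ultimately show ?thesis
      by (simp only: F_def sum.distrib)
  qed
  have unif: "uniformly_convergent_on (cball 0 s) F" if "s < 1" for s
  proof -
    have 1: "uniformly_convergent_on (cball 0 s) (\<lambda>N x. \<Sum>n<Suc N. qvec x * x ^ n * a n)"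
    proof -
      have "uniformly_convergent_on (cball 0 s) (\<lambda>N x. \<Sum>n<N. qvec x * x ^ n * a n)"
        using assms(2) that by (intro uniform_convergence_qvec_power_series) (auto simp: sums_iff)
      then obtain l where "uniform_limit (cball 0 s) (\<lambda>N x. \<Sum>n<N. qvec x * x ^ n * a n) l sequentially"
        by (auto simp: uniformly_convergent_on_def)
      from filterlim_compose[OF this filterlim_Suc] show ?thesis
        by (auto simp: uniformly_convergent_on_def)
    qed
    have 2: "uniformly_convergent_on (cball 0 s) (\<lambda>N x. \<Sum>n=1..N. T n x * a n)"
      unfolding T_def using that by (intro assms(3)) auto
    have 3: "uniformly_convergent_on (cball 0 s) (\<lambda>N. \<lambda>x. T 0 x * a 0)"
      by (rule uniformly_convergent_on_const)
    show ?thesis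
      using uniformly_convergent_add[OF 1 uniformly_convergent_add[OF 3 2]]
      unfolding F_eq[abs_def] .
  qed
  have sums: "(\<lambda>n. xi n x * a n) sums (\<Sum>n. xi n x * a n)" if "x \<in> ball 0 1" for x
  proof -
    have "uniformly_convergent_on (cball 0 (norm x)) F"
      using that by (intro unif) simp
    then obtain l where "uniform_limit (cball 0 (norm x)) F l sequentially"
      by (auto simp: uniformly_convergent_on_def)
    then have "(\<lambda>N. F N x) \<longlonglongrightarrow> l x"
      by (rule tendsto_uniform_limitI) simp
    then have "(\<lambda>n. xi n x * a n) sums l x"
      unfolding F_def sums_def by (rule LIMSEQ_imp_Suc)
    then show ?thesis
      by (simp add: sums_iff)
  qed
  have "(\<lambda>x. \<Sum>n. xi n x * a n) \<in> hyperholomorphic (ball 0 1)"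
  proof (rule hyperholomorphic_uniform_limit)
    show "F N \<in> hyperholomorphic (ball 0 1)" for N
      unfolding F_def by (intro hyperholomorphic_sum_right_mult hyperholomorphic_xi) simp
    show "uniform_limit (cball 0 s) F (\<lambda>x. \<Sum>n. xi n x * a n) sequentially" if s: "s < 1" for s
    proof -
      obtain l where l: "uniform_limit (cball 0 s) F l sequentially"
        using unif[OF s] by (auto simp: uniformly_convergent_on_def)
      have eq: "l x = (\<Sum>n. xi n x * a n)" if x: "x \<in> cball 0 s" for x
      proof (rule LIMSEQ_unique)
        show "(\<lambda>N. F N x) \<longlonglongrightarrow> l x"
          using l x by (rule tendsto_uniform_limitI)
        show "(\<lambda>N. F N x) \<longlonglongrightarrow> (\<Sum>n. xi n x * a n)"
          unfolding F_def using sums[of x] x \<open>s < 1\<close> unfolding sums_def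
          by (intro LIMSEQ_Suc) auto
      qed
      have "uniform_limit (cball 0 s) F l sequentially \<longleftrightarrow>
          uniform_limit (cball 0 s) F (\<lambda>x. \<Sum>n. xi n x * a n) sequentially"
        by (rule uniform_limit_cong') (simp_all only: eq)
      with l show ?thesis
        by blast
    qed
  qed
  then show ?thesis
    using sums by (auto simp: sums_iff)
qed

end
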